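(* Let $\mathcal{A}=(A,B,\beta,T)$ be a relative Rota-Baxter group and $\mathcal{K}=(K,L,\alpha,S)$ a module over $\mathcal{A}$ with respect to the action $(\nu,\mu,\sigma,f)$. Then the map $\Lambda\Pi\Psi:\operatorname{H}^2_{RRB}(\mathcal{A},\mathcal{K})\to\operatorname{H}^2_N(A_T,K_S)$ is a homomorphism of groups.
   Context: **Relative Rota-Baxter groups.** A relative Rota-Baxter group is a quadruple $(H,G,\phi,R)$ with $H,G$ groups, $\phi:G\to\operatorname{Aut}(H)$, $g\mapsto\phi_g$, a homomorphism, and $R:H\to G$ a map with $R(h_1)R(h_2)=R(h_1\phi_{R(h_1)}(h_2))$. It is trivial if $\phi$ is trivial (then $R$ is a homomorphism). A homomorphism $(\psi,\eta):(H,G,\phi,R)\to(H',G',\phi',R')$ is a pair of group homomorphisms with $\eta R=R'\psi$, $\psi\phi_g=\phi'_{\eta(g)}\psi$. An extension of $(A,B,\beta,T)$ by $(K,L,\alpha,S)$ is a relative Rota-Baxter group $(H,G,\phi,R)$ with an injective homomorphism $(i_1,i_2)$ from $(K,L,\alpha,S)$ and a surjective homomorphism $(\pi_1,\pi_2)$ onto $(A,B,\beta,T)$ such that $\operatorname{im} i_j=\ker\pi_j$, $j=1,2$; equivalence of extensions is isomorphism inducing identities on $(K,L,\alpha,S)$ and $(A,B,\beta,T)$. **Skew left braces.** A skew left brace is $(H,\cdot,\circ)$ with $(H,\cdot)$, $(H,\circ)$ groups and $a\circ(b\cdot c)=(a\circ b)\cdot a^{-1}\cdot(a\circ c)$. A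 relative Rota-Baxter group $(H,G,\phi,R)$ induces the skew left brace $H_R=(H,\cdot,\circ_R)$, $h_1\circ_Rh_2=h_1\phi_{R(h_1)}(h_2)$. An extension of relative Rota-Baxter groups induces the extension of skew left braces $1\to K_S\to H_R\to A_T\to 1$. Two extensions of skew left braces are equivalent if there is an isomorphism of the middle terms inducing identities on the ends. **Modules.** $\mathcal{K}=(K,L,\alpha,S)$, a trivial relative Rota-Baxter group with $K,L$ abelian, is an $\mathcal{A}$-module with action $(\nu,\mu,\sigma,f)$ if: (1) $\nu:B\to\operatorname{Aut}(K)$ is a homomorphism and $\mu:A\to\operatorname{Aut}(K)$ an anti-homomorphism; (2) $\sigma:B\to\operatorname{Aut}(L)$ is an anti-homomorphism; (3) $f:L\times A\to K$ satisfies $f(l_1l_2,a)=f(l_1,a)f(l_2,a)$ and $f(l,a_1a_2)=\mu_{a_2}(f(l,a_1))f(l,a_2)$; (4) $S(\nu^{-1}_{T(a)}(\mu_a(k))\,\nu^{-1}_{T(a)}(f(S(k),a)))=\sigma_{T(a)}(S(k))$; (5) $\nu_b(\mu_a(k))=\mu_{\beta_b(a)}(\nu_b(k))$; (6) $\nu_b(f(\sigma_b(l),a))=f(l,\beta_b(a))$. **$\operatorname{H}^2_{RRB}$.** $C^n(X,Y)$ (and $C(A\times B,K)$, $C(A,L)$, etc.) denote groups of maps sending tuples having an entry $1$ to $1$. $C^1_{RRB}=C^1(A,K)\oplus C^1(B,L)$, $C^2_{RRB}=C^2(A,K)\oplus C^2(B,L)\oplus C(A\times B,K)\oplus C(A,L)$.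 Put $\partial^1_\mu(\theta)(a_1,a_2)=\theta(a_2)\theta(a_1a_2)^{-1}\mu_{a_2}(\theta(a_1))$, $\partial^2_\mu(\tau)(a_1,a_2,a_3)=\tau(a_2,a_3)\tau(a_1a_2,a_3)^{-1}\tau(a_1,a_2a_3)\mu_{a_3}(\tau(a_1,a_2))^{-1}$, similarly $\partial^1_\sigma,\partial^2_\sigma$ with $(B,L,\sigma)$, and $\delta^1_\sigma(\chi)(a_1,a_2)=\chi(a_2)\chi(a_1\circ_Ta_2)^{-1}\sigma_{T(a_2)}(\chi(a_1))$. $\partial^1_{RRB}(\theta_1,\theta_2)=(\partial^1_\mu(\theta_1),\partial^1_\sigma(\theta_2),\lambda_1,\lambda_2)$, $\lambda_1(a,b)=\nu_b(f(\theta_2(b),a)\theta_1(a))\theta_1(\beta_b(a))^{-1}$, $\lambda_2(a)=S(\nu^{-1}_{T(a)}(\theta_1(a)))\theta_2(T(a))^{-1}$. $\partial^2_{RRB}(\tau_1,\tau_2,\rho,\chi)=(\partial^2_\mu(\tau_1),\partial^2_\sigma(\tau_2),\gamma_1,\gamma_2,\gamma_3)$ with $\gamma_1(a,b_1,b_2)=\rho(a,b_1b_2)\nu_{b_1b_2}(f(\tau_2(b_1,b_2),a))\rho(\beta_{b_2}(a),b_1)^{-1}\nu_{b_1}(\rho(a,b_2))^{-1}$, $\gamma_2(a_1,a_2,b)=\rho(a_1a_2,b)\nu_b(\tau_1(a_1,a_2))\mu_{\beta_b(a_2)}(\rho(a_1,b))^{-1}\rho(a_2,b)^{-1}\tau_1(\beta_b(a_1),\beta_b(a_2))^{-1}$,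 $\gamma_3(a_1,a_2)=S(\nu^{-1}_{T(a_1\circ_Ta_2)}(\rho(a_2,T(a_1))\tau_1(a_1,\beta_{T(a_1)}(a_2))\nu_{T(a_1)}(f(\chi(a_1),a_2))))\tau_2(T(a_1),T(a_2))^{-1}\delta^1_\sigma(\chi)(a_1,a_2)^{-1}$. $\operatorname{H}^2_{RRB}(\mathcal{A},\mathcal{K})=\ker\partial^2_{RRB}/\operatorname{im}\partial^1_{RRB}$. **$\operatorname{H}^2_N$.** Write $M=A_T=(A,\cdot,\circ)$ with $\circ=\circ_T$ and $I=K_S$ (the abelian group $K$ viewed as a trivial brace). Put $\xi_a=\nu_{T(a)}$, $\zeta_a=\mu_a$, $\epsilon_a(k)=\mu_{\beta_{T(a)^{-1}}(a)}(\nu_{T(a)^{-1}}(k))\,\nu_{T(a)^{-1}}(f(S(k),a))$. $\operatorname{Z}^2_N(M,I)$ is the group (under pointwise multiplication) of pairs $(g,h)$ of maps $M\times M\to I$ vanishing on degenerate tuples with, for all $m_i\in M$: $g(m_2,m_3)\,g(m_1m_2,m_3)^{-1}g(m_1,m_2m_3)\,\zeta_{m_3}(g(m_1,m_2))^{-1}=1$; $\xi_{m_1}(h(m_2,m_3))\,h(m_1\circ m_2,m_3)^{-1}h(m_1,m_2\circ m_3)\,\xi_{m_1\circ m_2\circ m_3}(\epsilon_{m_3}(\xi^{-1}_{m_1\circ m_2}(h(m_1,m_2))))^{-1}=1$; $\xi_{m_1}(g(m_2,m_3))\,\zeta_{m_1\circ m_3}(g(m_1,m_1^{-1}))\,\zeta_{m_1\circ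 m_3}(g(m_1\circ m_2,m_1^{-1}))^{-1}g((m_1\circ m_2)m_1^{-1},m_1\circ m_3)^{-1}\,\zeta_{m_1^{-1}(m_1\circ m_3)}(h(m_1,m_2))^{-1}h(m_1,m_2m_3)\,h(m_1,m_3)^{-1}=1$. $\operatorname{B}^2_N(M,I)$ consists of those $(g,h)\in \operatorname{Z}^2_N(M,I)$ for which there is $\theta:M\to I$ with $g(m_1,m_2)=\xi_{m_1m_2}(\theta(m_1m_2)^{-1})\zeta_{m_2}(\xi_{m_1}(\theta(m_1)))\xi_{m_2}(\theta(m_2))$ and $h(m_1,m_2)=\xi_{m_1\circ m_2}\big(\theta(m_1\circ m_2)^{-1}\epsilon_{m_2}(\theta(m_1))\theta(m_2)\big)$. $\operatorname{H}^2_N(M,I)=\operatorname{Z}^2_N(M,I)/\operatorname{B}^2_N(M,I)$. **The map.** $\Psi$ sends $[(\tau_1,\tau_2,\rho,\chi)]$ to the equivalence class of the extension $(H,G,\phi,R)$ where $H=A\times K$ with $(a_1,k_1)(a_2,k_2)=(a_1a_2,\mu_{a_2}(k_1)k_2\tau_1(a_1,a_2))$, $G=B\times L$ with $(b_1,l_1)(b_2,l_2)=(b_1b_2,\sigma_{b_2}(l_1)l_2\tau_2(b_1,b_2))$, $\phi_{(b,l)}(a,k)=(\beta_b(a),\rho(a,b)\nu_b(f(l,a)k))$, $R(a,k)=(T(a),\chi(a)S(\nu^{-1}_{T(a)}(k)))$. $\Pi$ sends the class of an extension of relative Rota-Baxter groups to the class of the induced extension of skew left braces. $\Lambda$ sends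 the class of an extension $1\to K_S\to E\to A_T\to1$ of skew left braces to $[(\tau,\tilde\tau)]$, where for a set-theoretic section $s:A\to E$ with $s(1)=1$, $\tau(m_1,m_2)=s(m_1m_2)^{-1}s(m_1)s(m_2)$ and $\tilde\tau(m_1,m_2)=s(m_1\circ m_2)^{-1}(s(m_1)\circ s(m_2))$. Explicitly, $\Lambda\Pi\Psi([(\tau_1,\tau_2,\rho,\chi)])=[(\tau_1,h)]$ with $h(a_1,a_2)=\tau_1(a_1,\beta_{T(a_1)}(a_2))\,\rho(a_2,T(a_1))\,\nu_{T(a_1)}(f(\chi(a_1),a_2))$. *)

theory Defs
  imports "HOL-Algebra.Bij" "HOL-Algebra.Product_Groups"
begin

section \<open>Relative Rota-Baxter groups\<close>

text \<open>
  A quadruple \<open>(H, G, \<phi>, R)\<close>. The action takes values in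
  \<^const>\<open>AutoGroup\<close>, so each \<open>\<phi> g\<close> is extensional on \<open>carrier H\<close>; all other functions
  are only constrained on the carriers.
\<close>

record ('h, 'g) rrb =
  rrb_H :: "'h monoid"
  rrb_G :: "'g monoid"
  rrb_act :: "'g \<Rightarrow> 'h \<Rightarrow> 'h"
  rrb_op :: "'h \<Rightarrow> 'g"

definition rrb_group :: "('h, 'g) rrb \<Rightarrow> bool" where
  "rrb_group X \<longleftrightarrow>
     group (rrb_H X) \<and> group (rrb_G X) \<and>
     rrb_act X \<in> hom (rrb_G X) (AutoGroup (rrb_H X)) \<and>
     rrb_op X \<in> carrier (rrb_H X) \<rightarrow> carrier (rrb_G X) \<and>
     (\<forall>x\<in>carrier (rrb_H X). \<forall>y\<in>carrier (rrb_H X).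
        rrb_op X x \<otimes>\<^bsub>rrb_G X\<^esub> rrb_op X y
          = rrb_op X (x \<otimes>\<^bsub>rrb_H X\<^esub> rrb_act X (rrb_op X x) y))"

definition rrb_trivial :: "('h, 'g) rrb \<Rightarrow> bool" where
  "rrb_trivial X \<longleftrightarrow> (\<forall>g\<in>carrier (rrb_G X). \<forall>h\<in>carrier (rrb_H X). rrb_act X g h = h)"

definition rrb_hom ::
  "('h, 'g) rrb \<Rightarrow> ('h2, 'g2) rrb \<Rightarrow> (('h \<Rightarrow> 'h2) \<times> ('g \<Rightarrow> 'g2)) set" where
  "rrb_hom X Y = {(\<psi>, \<eta>).
     \<psi> \<in> hom (rrb_H X) (rrb_H Y) \<and> \<eta> \<in> hom (rrb_G X) (rrb_G Y) \<and>
     (\<forall>h\<in>carrier (rrb_H X). \<eta> (rrb_op X h) = rrb_op Y (\<psi> h)) \<and>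
     (\<forall>g\<in>carrier (rrb_G X). \<forall>h\<in>carrier (rrb_H X).
        \<psi> (rrb_act X g h) = rrb_act Y (\<eta> g) (\<psi> h))}"

record ('k, 'l, 'h, 'g, 'a, 'b) rrb_ext =
  ext_mid :: "('h, 'g) rrb"
  ext_i1 :: "'k \<Rightarrow> 'h"
  ext_i2 :: "'l \<Rightarrow> 'g"
  ext_p1 :: "'h \<Rightarrow> 'a"
  ext_p2 :: "'g \<Rightarrow> 'b"

definition rrb_extension ::
  "('a, 'b) rrb \<Rightarrow> ('k, 'l) rrb \<Rightarrow> ('k, 'l, 'h, 'g, 'a, 'b) rrb_ext \<Rightarrow> bool" where
  "rrb_extension A K E \<longleftrightarrow>
     rrb_group (ext_mid E) \<and>
     (ext_i1 E, ext_i2 E) \<in> rrb_hom K (ext_mid E) \<and>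
     inj_on (ext_i1 E) (carrier (rrb_H K)) \<and> inj_on (ext_i2 E) (carrier (rrb_G K)) \<and>
     (ext_p1 E, ext_p2 E) \<in> rrb_hom (ext_mid E) A \<and>
     ext_p1 E ` carrier (rrb_H (ext_mid E)) = carrier (rrb_H A) \<and>
     ext_p2 E ` carrier (rrb_G (ext_mid E)) = carrier (rrb_G A) \<and>
     ext_i1 E ` carrier (rrb_H K) = kernel (rrb_H (ext_mid E)) (rrb_H A) (ext_p1 E) \<and>
     ext_i2 E ` carrier (rrb_G K) = kernel (rrb_G (ext_mid E)) (rrb_G A) (ext_p2 E)"

definition rrb_ext_equiv ::
  "('a, 'b) rrb \<Rightarrow> ('k, 'l) rrb \<Rightarrow> ('k, 'l, 'h, 'g, 'a, 'b) rrb_ext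
     \<Rightarrow> ('k, 'l, 'h2, 'g2, 'a, 'b) rrb_ext \<Rightarrow> bool" where
  "rrb_ext_equiv A K E F \<longleftrightarrow> (\<exists>\<psi> \<eta>.
     (\<psi>, \<eta>) \<in> rrb_hom (ext_mid E) (ext_mid F) \<and>
     bij_betw \<psi> (carrier (rrb_H (ext_mid E))) (carrier (rrb_H (ext_mid F))) \<and>
     bij_betw \<eta> (carrier (rrb_G (ext_mid E))) (carrier (rrb_G (ext_mid F))) \<and>
     (\<forall>k\<in>carrier (rrb_H K). \<psi> (ext_i1 E k) = ext_i1 F k) \<and>
     (\<forall>l\<in>carrier (rrb_G K). \<eta> (ext_i2 E l) = ext_i2 F l) \<and>
     (\<forall>h\<in>carrier (rrb_H (ext_mid E)). ext_p1 F (\<psi> h) = ext_p1 E h) \<and>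
     (\<forall>g\<in>carrier (rrb_G (ext_mid E)). ext_p2 F (\<eta> g) = ext_p2 E g))"

text \<open>
  Equivalence classes are taken among extensions whose middle groups live on fixed types.
  For the types \<open>'a \<times> 'k\<close> and \<open>'b \<times> 'l\<close> used below nothing is lost: the choice of
  sections identifies the middle groups of any extension with \<open>A \<times> K\<close> and \<open>B \<times> L\<close> as sets.
\<close>

definition rrb_ext_class ::
  "('a, 'b) rrb \<Rightarrow> ('k, 'l) rrb \<Rightarrow> ('k, 'l, 'h, 'g, 'a, 'b) rrb_ext
     \<Rightarrow> ('k, 'l, 'h, 'g, 'a, 'b) rrb_ext set" where
  "rrb_ext_class A K E = {F. rrb_extension A K F \<and> rrb_ext_equiv A K E F}"


section \<open>Skew left braces\<close>

text \<open>
  Both group structures share the unit: putting \<open>b = c = 1\<close> in the brace identity gives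
  \<open>a \<circ> 1 = a\<close>, so the two units always coincide.
\<close>

record 'a skew_brace = "'a monoid" +
  circ :: "'a \<Rightarrow> 'a \<Rightarrow> 'a"

definition circ_group :: "'a skew_brace \<Rightarrow> 'a monoid" where
  "circ_group M = \<lparr>carrier = carrier M, mult = circ M, one = one M\<rparr>"

definition skew_left_brace :: "'a skew_brace \<Rightarrow> bool" where
  "skew_left_brace M \<longleftrightarrow>
     group M \<and> group (circ_group M) \<and>
     (\<forall>a\<in>carrier M. \<forall>b\<in>carrier M. \<forall>c\<in>carrier M.
        circ M a (b \<otimes>\<^bsub>M\<^esub> c) = circ M a b \<otimes>\<^bsub>M\<^esub> inv\<^bsub>M\<^esub> a \<otimes>\<^bsub>M\<^esub> circ M a c)"

definition skew_brace_hom :: "'a skew_brace \<Rightarrow> 'b skew_brace \<Rightarrow> ('a \<Rightarrow> 'b) set" where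
  "skew_brace_hom M N = hom M N \<inter> hom (circ_group M) (circ_group N)"

definition induced_brace :: "('h, 'g) rrb \<Rightarrow> 'h skew_brace" where
  "induced_brace X =
     \<lparr>carrier = carrier (rrb_H X), mult = mult (rrb_H X), one = one (rrb_H X),
      circ = (\<lambda>x y. x \<otimes>\<^bsub>rrb_H X\<^esub> rrb_act X (rrb_op X x) y)\<rparr>"

record ('i, 'e, 'm) brace_ext =
  bext_mid :: "'e skew_brace"
  bext_i :: "'i \<Rightarrow> 'e"
  bext_p :: "'e \<Rightarrow> 'm"

definition brace_extension ::
  "'m skew_brace \<Rightarrow> 'i skew_brace \<Rightarrow> ('i, 'e, 'm) brace_ext \<Rightarrow> bool" where
  "brace_extension M I E \<longleftrightarrow>
     skew_left_brace (bext_mid E) \<and>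
     bext_i E \<in> skew_brace_hom I (bext_mid E) \<and> inj_on (bext_i E) (carrier I) \<and>
     bext_p E \<in> skew_brace_hom (bext_mid E) M \<and>
     bext_p E ` carrier (bext_mid E) = carrier M \<and>
     bext_i E ` carrier I = kernel (bext_mid E) M (bext_p E)"

definition brace_ext_equiv ::
  "'m skew_brace \<Rightarrow> 'i skew_brace \<Rightarrow> ('i, 'e, 'm) brace_ext \<Rightarrow> ('i, 'f, 'm) brace_ext \<Rightarrow> bool" where
  "brace_ext_equiv M I E F \<longleftrightarrow> (\<exists>\<psi>.
     \<psi> \<in> skew_brace_hom (bext_mid E) (bext_mid F) \<and>
     bij_betw \<psi> (carrier (bext_mid E)) (carrier (bext_mid F)) \<and>
     (\<forall>y\<in>carrier I. \<psi> (bext_i E y) = bext_i F y) \<and>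
     (\<forall>x\<in>carrier (bext_mid E). bext_p F (\<psi> x) = bext_p E x))"

definition brace_ext_class ::
  "'m skew_brace \<Rightarrow> 'i skew_brace \<Rightarrow> ('i, 'e, 'm) brace_ext \<Rightarrow> ('i, 'e, 'm) brace_ext set" where
  "brace_ext_class M I E = {F. brace_extension M I F \<and> brace_ext_equiv M I E F}"

definition induced_brace_ext ::
  "('k, 'l, 'h, 'g, 'a, 'b) rrb_ext \<Rightarrow> ('k, 'h, 'a) brace_ext" where
  "induced_brace_ext E =
     \<lparr>bext_mid = induced_brace (ext_mid E), bext_i = ext_i1 E, bext_p = ext_p1 E\<rparr>"


section \<open>Modules\<close>

definition antihom :: "('a, 'm) monoid_scheme \<Rightarrow> ('b, 'n) monoid_scheme \<Rightarrow> ('a \<Rightarrow> 'b) set" where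
  "antihom G H = {h. h \<in> carrier G \<rightarrow> carrier H \<and>
     (\<forall>x\<in>carrier G. \<forall>y\<in>carrier G. h (x \<otimes>\<^bsub>G\<^esub> y) = h y \<otimes>\<^bsub>H\<^esub> h x)}"

definition rrb_module ::
  "('a, 'b) rrb \<Rightarrow> ('k, 'l) rrb \<Rightarrow> ('b \<Rightarrow> 'k \<Rightarrow> 'k) \<Rightarrow> ('a \<Rightarrow> 'k \<Rightarrow> 'k)
     \<Rightarrow> ('b \<Rightarrow> 'l \<Rightarrow> 'l) \<Rightarrow> ('l \<Rightarrow> 'a \<Rightarrow> 'k) \<Rightarrow> bool" where
  "rrb_module A K \<nu> \<mu> \<sigma> f \<longleftrightarrow>
     rrb_group K \<and> rrb_trivial K \<and> comm_group (rrb_H K) \<and> comm_group (rrb_G K) \<and>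
     \<nu> \<in> hom (rrb_G A) (AutoGroup (rrb_H K)) \<and>
     \<mu> \<in> antihom (rrb_H A) (AutoGroup (rrb_H K)) \<and>
     \<sigma> \<in> antihom (rrb_G A) (AutoGroup (rrb_G K)) \<and>
     f \<in> carrier (rrb_G K) \<rightarrow> carrier (rrb_H A) \<rightarrow> carrier (rrb_H K) \<and>
     (\<forall>l1\<in>carrier (rrb_G K). \<forall>l2\<in>carrier (rrb_G K). \<forall>a\<in>carrier (rrb_H A).
        f (l1 \<otimes>\<^bsub>rrb_G K\<^esub> l2) a = f l1 a \<otimes>\<^bsub>rrb_H K\<^esub> f l2 a) \<and>
     (\<forall>l\<in>carrier (rrb_G K). \<forall>a1\<in>carrier (rrb_H A). \<forall>a2\<in>carrier (rrb_H A).
        f l (a1 \<otimes>\<^bsub>rrb_H A\<^esub> a2) = \<mu> a2 (f l a1) \<otimes>\<^bsub>rrb_H K\<^esub> f l a2) \<and>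
     (\<forall>a\<in>carrier (rrb_H A). \<forall>k\<in>carrier (rrb_H K).
        rrb_op K ((inv\<^bsub>AutoGroup (rrb_H K)\<^esub> (\<nu> (rrb_op A a))) (\<mu> a k) \<otimes>\<^bsub>rrb_H K\<^esub>
                  (inv\<^bsub>AutoGroup (rrb_H K)\<^esub> (\<nu> (rrb_op A a))) (f (rrb_op K k) a))
          = \<sigma> (rrb_op A a) (rrb_op K k)) \<and>
     (\<forall>a\<in>carrier (rrb_H A). \<forall>b\<in>carrier (rrb_G A). \<forall>k\<in>carrier (rrb_H K).
        \<nu> b (\<mu> a k) = \<mu> (rrb_act A b a) (\<nu> b k)) \<and>
     (\<forall>a\<in>carrier (rrb_H A). \<forall>b\<in>carrier (rrb_G A). \<forall>l\<in>carrier (rrb_G K).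
        \<nu> b (f (\<sigma> b l) a) = f l (rrb_act A b a))"


section \<open>Cochain groups\<close>

text \<open>
  Cochains are extensional functions of one tuple argument, with pointwise multiplication;
  the second argument \<open>N\<close> is the set of tuples on which they have to be trivial.
\<close>

definition cochain_group :: "'x set \<Rightarrow> 'x set \<Rightarrow> ('y, 'n) monoid_scheme \<Rightarrow> ('x \<Rightarrow> 'y) monoid" where
  "cochain_group D N Y =
     (product_group D (\<lambda>_. Y))
       \<lparr>carrier := {c \<in> carrier (product_group D (\<lambda>_. Y)). \<forall>x\<in>D \<inter> N. c x = \<one>\<^bsub>Y\<^esub>}\<rparr>"

definition cochains1 ::
  "('x, 'm) monoid_scheme \<Rightarrow> ('y, 'n) monoid_scheme \<Rightarrow> ('x \<Rightarrow> 'y) monoid" where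
  "cochains1 X Y = cochain_group (carrier X) {\<one>\<^bsub>X\<^esub>} Y"

definition cochains2 ::
  "('x1, 'm1) monoid_scheme \<Rightarrow> ('x2, 'm2) monoid_scheme \<Rightarrow> ('y, 'n) monoid_scheme
     \<Rightarrow> ('x1 \<times> 'x2 \<Rightarrow> 'y) monoid" where
  "cochains2 X1 X2 Y = cochain_group (carrier X1 \<times> carrier X2)
     {(x1, x2). x1 = \<one>\<^bsub>X1\<^esub> \<or> x2 = \<one>\<^bsub>X2\<^esub>} Y"

definition cochains3 ::
  "('x1, 'm1) monoid_scheme \<Rightarrow> ('x2, 'm2) monoid_scheme \<Rightarrow> ('x3, 'm3) monoid_scheme
     \<Rightarrow> ('y, 'n) monoid_scheme \<Rightarrow> ('x1 \<times> 'x2 \<times> 'x3 \<Rightarrow> 'y) monoid" where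
  "cochains3 X1 X2 X3 Y = cochain_group (carrier X1 \<times> carrier X2 \<times> carrier X3)
     {(x1, x2, x3). x1 = \<one>\<^bsub>X1\<^esub> \<or> x2 = \<one>\<^bsub>X2\<^esub> \<or> x3 = \<one>\<^bsub>X3\<^esub>} Y"


section \<open>The second cohomology group of a relative Rota-Baxter group\<close>

definition d1 ::
  "'x monoid \<Rightarrow> 'y monoid \<Rightarrow> ('x \<Rightarrow> 'y \<Rightarrow> 'y) \<Rightarrow> ('x \<Rightarrow> 'y) \<Rightarrow> 'x \<times> 'x \<Rightarrow> 'y" where
  "d1 X Y \<mu> \<theta> = (\<lambda>(x1, x2)\<in>carrier X \<times> carrier X.
     \<theta> x2 \<otimes>\<^bsub>Y\<^esub> inv\<^bsub>Y\<^esub> (\<theta> (x1 \<otimes>\<^bsub>X\<^esub> x2)) \<otimes>\<^bsub>Y\<^esub> \<mu> x2 (\<theta> x1))"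

definition d2 ::
  "'x monoid \<Rightarrow> 'y monoid \<Rightarrow> ('x \<Rightarrow> 'y \<Rightarrow> 'y) \<Rightarrow> ('x \<times> 'x \<Rightarrow> 'y) \<Rightarrow> 'x \<times> 'x \<times> 'x \<Rightarrow> 'y" where
  "d2 X Y \<mu> \<tau> = (\<lambda>(x1, x2, x3)\<in>carrier X \<times> carrier X \<times> carrier X.
     \<tau> (x2, x3) \<otimes>\<^bsub>Y\<^esub> inv\<^bsub>Y\<^esub> (\<tau> (x1 \<otimes>\<^bsub>X\<^esub> x2, x3)) \<otimes>\<^bsub>Y\<^esub>
     \<tau> (x1, x2 \<otimes>\<^bsub>X\<^esub> x3) \<otimes>\<^bsub>Y\<^esub> inv\<^bsub>Y\<^esub> (\<mu> x3 (\<tau> (x1, x2))))"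

definition C1_RRB ::
  "('a, 'b) rrb \<Rightarrow> ('k, 'l) rrb \<Rightarrow> (('a \<Rightarrow> 'k) \<times> ('b \<Rightarrow> 'l)) monoid" where
  "C1_RRB A K = cochains1 (rrb_H A) (rrb_H K) \<times>\<times> cochains1 (rrb_G A) (rrb_G K)"

type_synonym ('a, 'b, 'k, 'l) cochain2_RRB =
  "('a \<times> 'a \<Rightarrow> 'k) \<times> ('b \<times> 'b \<Rightarrow> 'l) \<times> ('a \<times> 'b \<Rightarrow> 'k) \<times> ('a \<Rightarrow> 'l)"

definition C2_RRB ::
  "('a, 'b) rrb \<Rightarrow> ('k, 'l) rrb \<Rightarrow> ('a, 'b, 'k, 'l) cochain2_RRB monoid" where
  "C2_RRB A K =
     cochains2 (rrb_H A) (rrb_H A) (rrb_H K) \<times>\<times>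
     cochains2 (rrb_G A) (rrb_G A) (rrb_G K) \<times>\<times>
     cochains2 (rrb_H A) (rrb_G A) (rrb_H K) \<times>\<times>
     cochains1 (rrb_H A) (rrb_G K)"

type_synonym ('a, 'b, 'k, 'l) cochain3_RRB =
  "('a \<times> 'a \<times> 'a \<Rightarrow> 'k) \<times> ('b \<times> 'b \<times> 'b \<Rightarrow> 'l) \<times>
   ('a \<times> 'b \<times> 'b \<Rightarrow> 'k) \<times> ('a \<times> 'a \<times> 'b \<Rightarrow> 'k) \<times> ('a \<times> 'a \<Rightarrow> 'l)"

definition C3_RRB ::
  "('a, 'b) rrb \<Rightarrow> ('k, 'l) rrb \<Rightarrow> ('a, 'b, 'k, 'l) cochain3_RRB monoid" where
  "C3_RRB A K =
     cochains3 (rrb_H A) (rrb_H A) (rrb_H A) (rrb_H K) \<times>\<times>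
     cochains3 (rrb_G A) (rrb_G A) (rrb_G A) (rrb_G K) \<times>\<times>
     cochains3 (rrb_H A) (rrb_G A) (rrb_G A) (rrb_H K) \<times>\<times>
     cochains3 (rrb_H A) (rrb_H A) (rrb_G A) (rrb_H K) \<times>\<times>
     cochains2 (rrb_H A) (rrb_H A) (rrb_G K)"

definition d1_RRB ::
  "('a, 'b) rrb \<Rightarrow> ('k, 'l) rrb \<Rightarrow> ('b \<Rightarrow> 'k \<Rightarrow> 'k) \<Rightarrow> ('a \<Rightarrow> 'k \<Rightarrow> 'k)
     \<Rightarrow> ('b \<Rightarrow> 'l \<Rightarrow> 'l) \<Rightarrow> ('l \<Rightarrow> 'a \<Rightarrow> 'k)
     \<Rightarrow> ('a \<Rightarrow> 'k) \<times> ('b \<Rightarrow> 'l) \<Rightarrow> ('a, 'b, 'k, 'l) cochain2_RRB" where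
  "d1_RRB A K \<nu> \<mu> \<sigma> f = (\<lambda>(\<theta>1, \<theta>2).
     (d1 (rrb_H A) (rrb_H K) \<mu> \<theta>1,
      d1 (rrb_G A) (rrb_G K) \<sigma> \<theta>2,
      (\<lambda>(a, b)\<in>carrier (rrb_H A) \<times> carrier (rrb_G A).
         \<nu> b (f (\<theta>2 b) a \<otimes>\<^bsub>rrb_H K\<^esub> \<theta>1 a) \<otimes>\<^bsub>rrb_H K\<^esub>
         inv\<^bsub>rrb_H K\<^esub> (\<theta>1 (rrb_act A b a))),
      (\<lambda>a\<in>carrier (rrb_H A).
         rrb_op K ((inv\<^bsub>AutoGroup (rrb_H K)\<^esub> (\<nu> (rrb_op A a))) (\<theta>1 a)) \<otimes>\<^bsub>rrb_G K\<^esub>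
         inv\<^bsub>rrb_G K\<^esub> (\<theta>2 (rrb_op A a)))))"

definition delta1 ::
  "('a, 'b) rrb \<Rightarrow> ('k, 'l) rrb \<Rightarrow> ('b \<Rightarrow> 'l \<Rightarrow> 'l) \<Rightarrow> ('a \<Rightarrow> 'l) \<Rightarrow> 'a \<times> 'a \<Rightarrow> 'l" where
  "delta1 A K \<sigma> \<chi> = (\<lambda>(a1, a2)\<in>carrier (rrb_H A) \<times> carrier (rrb_H A).
     \<chi> a2 \<otimes>\<^bsub>rrb_G K\<^esub> inv\<^bsub>rrb_G K\<^esub> (\<chi> (circ (induced_brace A) a1 a2)) \<otimes>\<^bsub>rrb_G K\<^esub>
     \<sigma> (rrb_op A a2) (\<chi> a1))"

definition d2_RRB ::
  "('a, 'b) rrb \<Rightarrow> ('k, 'l) rrb \<Rightarrow> ('b \<Rightarrow> 'k \<Rightarrow> 'k) \<Rightarrow> ('a \<Rightarrow> 'k \<Rightarrow> 'k)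
     \<Rightarrow> ('b \<Rightarrow> 'l \<Rightarrow> 'l) \<Rightarrow> ('l \<Rightarrow> 'a \<Rightarrow> 'k)
     \<Rightarrow> ('a, 'b, 'k, 'l) cochain2_RRB \<Rightarrow> ('a, 'b, 'k, 'l) cochain3_RRB" where
  "d2_RRB A K \<nu> \<mu> \<sigma> f = (\<lambda>(\<tau>1, \<tau>2, \<rho>, \<chi>).
     (d2 (rrb_H A) (rrb_H K) \<mu> \<tau>1,
      d2 (rrb_G A) (rrb_G K) \<sigma> \<tau>2,
      (\<lambda>(a, b1, b2)\<in>carrier (rrb_H A) \<times> carrier (rrb_G A) \<times> carrier (rrb_G A).
         \<rho> (a, b1 \<otimes>\<^bsub>rrb_G A\<^esub> b2) \<otimes>\<^bsub>rrb_H K\<^esub>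
         \<nu> (b1 \<otimes>\<^bsub>rrb_G A\<^esub> b2) (f (\<tau>2 (b1, b2)) a) \<otimes>\<^bsub>rrb_H K\<^esub>
         inv\<^bsub>rrb_H K\<^esub> (\<rho> (rrb_act A b2 a, b1)) \<otimes>\<^bsub>rrb_H K\<^esub>
         inv\<^bsub>rrb_H K\<^esub> (\<nu> b1 (\<rho> (a, b2)))),
      (\<lambda>(a1, a2, b)\<in>carrier (rrb_H A) \<times> carrier (rrb_H A) \<times> carrier (rrb_G A).
         \<rho> (a1 \<otimes>\<^bsub>rrb_H A\<^esub> a2, b) \<otimes>\<^bsub>rrb_H K\<^esub>
         \<nu> b (\<tau>1 (a1, a2)) \<otimes>\<^bsub>rrb_H K\<^esub>
         inv\<^bsub>rrb_H K\<^esub> (\<mu> (rrb_act A b a2) (\<rho> (a1, b))) \<otimes>\<^bsub>rrb_H K\<^esub>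
         inv\<^bsub>rrb_H K\<^esub> (\<rho> (a2, b)) \<otimes>\<^bsub>rrb_H K\<^esub>
         inv\<^bsub>rrb_H K\<^esub> (\<tau>1 (rrb_act A b a1, rrb_act A b a2))),
      (\<lambda>(a1, a2)\<in>carrier (rrb_H A) \<times> carrier (rrb_H A).
         rrb_op K
           ((inv\<^bsub>AutoGroup (rrb_H K)\<^esub> (\<nu> (rrb_op A (circ (induced_brace A) a1 a2))))
              (\<rho> (a2, rrb_op A a1) \<otimes>\<^bsub>rrb_H K\<^esub>
               \<tau>1 (a1, rrb_act A (rrb_op A a1) a2) \<otimes>\<^bsub>rrb_H K\<^esub>
               \<nu> (rrb_op A a1) (f (\<chi> a1) a2))) \<otimes>\<^bsub>rrb_G K\<^esub>
         inv\<^bsub>rrb_G K\<^esub> (\<tau>2 (rrb_op A a1, rrb_op A a2)) \<otimes>\<^bsub>rrb_G K\<^esub>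
         inv\<^bsub>rrb_G K\<^esub> (delta1 A K \<sigma> \<chi> (a1, a2)))))"

definition Z2_RRB ::
  "('a, 'b) rrb \<Rightarrow> ('k, 'l) rrb \<Rightarrow> ('b \<Rightarrow> 'k \<Rightarrow> 'k) \<Rightarrow> ('a \<Rightarrow> 'k \<Rightarrow> 'k)
     \<Rightarrow> ('b \<Rightarrow> 'l \<Rightarrow> 'l) \<Rightarrow> ('l \<Rightarrow> 'a \<Rightarrow> 'k) \<Rightarrow> ('a, 'b, 'k, 'l) cochain2_RRB monoid" where
  "Z2_RRB A K \<nu> \<mu> \<sigma> f =
     (C2_RRB A K)\<lparr>carrier := kernel (C2_RRB A K) (C3_RRB A K) (d2_RRB A K \<nu> \<mu> \<sigma> f)\<rparr>"

definition B2_RRB ::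
  "('a, 'b) rrb \<Rightarrow> ('k, 'l) rrb \<Rightarrow> ('b \<Rightarrow> 'k \<Rightarrow> 'k) \<Rightarrow> ('a \<Rightarrow> 'k \<Rightarrow> 'k)
     \<Rightarrow> ('b \<Rightarrow> 'l \<Rightarrow> 'l) \<Rightarrow> ('l \<Rightarrow> 'a \<Rightarrow> 'k) \<Rightarrow> ('a, 'b, 'k, 'l) cochain2_RRB set" where
  "B2_RRB A K \<nu> \<mu> \<sigma> f = d1_RRB A K \<nu> \<mu> \<sigma> f ` carrier (C1_RRB A K)"

definition H2_RRB ::
  "('a, 'b) rrb \<Rightarrow> ('k, 'l) rrb \<Rightarrow> ('b \<Rightarrow> 'k \<Rightarrow> 'k) \<Rightarrow> ('a \<Rightarrow> 'k \<Rightarrow> 'k)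
     \<Rightarrow> ('b \<Rightarrow> 'l \<Rightarrow> 'l) \<Rightarrow> ('l \<Rightarrow> 'a \<Rightarrow> 'k) \<Rightarrow> ('a, 'b, 'k, 'l) cochain2_RRB set monoid" where
  "H2_RRB A K \<nu> \<mu> \<sigma> f = Z2_RRB A K \<nu> \<mu> \<sigma> f Mod B2_RRB A K \<nu> \<mu> \<sigma> f"


section \<open>The second cohomology group of a skew left brace\<close>

definition Z2_N ::
  "'m skew_brace \<Rightarrow> 'i skew_brace \<Rightarrow> ('m \<Rightarrow> 'i \<Rightarrow> 'i) \<Rightarrow> ('m \<Rightarrow> 'i \<Rightarrow> 'i) \<Rightarrow> ('m \<Rightarrow> 'i \<Rightarrow> 'i)
     \<Rightarrow> (('m \<times> 'm \<Rightarrow> 'i) \<times> ('m \<times> 'm \<Rightarrow> 'i)) monoid" where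
  "Z2_N M I \<xi> \<zeta> \<epsilon> = (cochains2 M M I \<times>\<times> cochains2 M M I)
     \<lparr>carrier := {(g, h) \<in> carrier (cochains2 M M I \<times>\<times> cochains2 M M I).
        \<forall>m1\<in>carrier M. \<forall>m2\<in>carrier M. \<forall>m3\<in>carrier M.
          g (m2, m3) \<otimes>\<^bsub>I\<^esub> inv\<^bsub>I\<^esub> (g (m1 \<otimes>\<^bsub>M\<^esub> m2, m3)) \<otimes>\<^bsub>I\<^esub>
          g (m1, m2 \<otimes>\<^bsub>M\<^esub> m3) \<otimes>\<^bsub>I\<^esub> inv\<^bsub>I\<^esub> (\<zeta> m3 (g (m1, m2))) = \<one>\<^bsub>I\<^esub> \<and>
          \<xi> m1 (h (m2, m3)) \<otimes>\<^bsub>I\<^esub> inv\<^bsub>I\<^esub> (h (circ M m1 m2, m3)) \<otimes>\<^bsub>I\<^esub>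
          h (m1, circ M m2 m3) \<otimes>\<^bsub>I\<^esub>
          inv\<^bsub>I\<^esub> (\<xi> (circ M (circ M m1 m2) m3)
                 (\<epsilon> m3 ((inv\<^bsub>AutoGroup I\<^esub> (\<xi> (circ M m1 m2))) (h (m1, m2))))) = \<one>\<^bsub>I\<^esub> \<and>
          \<xi> m1 (g (m2, m3)) \<otimes>\<^bsub>I\<^esub>
          \<zeta> (circ M m1 m3) (g (m1, inv\<^bsub>M\<^esub> m1)) \<otimes>\<^bsub>I\<^esub>
          inv\<^bsub>I\<^esub> (\<zeta> (circ M m1 m3) (g (circ M m1 m2, inv\<^bsub>M\<^esub> m1))) \<otimes>\<^bsub>I\<^esub>
          inv\<^bsub>I\<^esub> (g (circ M m1 m2 \<otimes>\<^bsub>M\<^esub> inv\<^bsub>M\<^esub> m1, circ M m1 m3)) \<otimes>\<^bsub>I\<^esub>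
          inv\<^bsub>I\<^esub> (\<zeta> (inv\<^bsub>M\<^esub> m1 \<otimes>\<^bsub>M\<^esub> circ M m1 m3) (h (m1, m2))) \<otimes>\<^bsub>I\<^esub>
          h (m1, m2 \<otimes>\<^bsub>M\<^esub> m3) \<otimes>\<^bsub>I\<^esub> inv\<^bsub>I\<^esub> (h (m1, m3)) = \<one>\<^bsub>I\<^esub>}\<rparr>"

definition B2_N ::
  "'m skew_brace \<Rightarrow> 'i skew_brace \<Rightarrow> ('m \<Rightarrow> 'i \<Rightarrow> 'i) \<Rightarrow> ('m \<Rightarrow> 'i \<Rightarrow> 'i) \<Rightarrow> ('m \<Rightarrow> 'i \<Rightarrow> 'i)
     \<Rightarrow> (('m \<times> 'm \<Rightarrow> 'i) \<times> ('m \<times> 'm \<Rightarrow> 'i)) set" where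
  "B2_N M I \<xi> \<zeta> \<epsilon> = {(g, h) \<in> carrier (Z2_N M I \<xi> \<zeta> \<epsilon>).
     \<exists>\<theta>\<in>carrier M \<rightarrow> carrier I. \<forall>m1\<in>carrier M. \<forall>m2\<in>carrier M.
       g (m1, m2) = \<xi> (m1 \<otimes>\<^bsub>M\<^esub> m2) (inv\<^bsub>I\<^esub> (\<theta> (m1 \<otimes>\<^bsub>M\<^esub> m2))) \<otimes>\<^bsub>I\<^esub>
                    \<zeta> m2 (\<xi> m1 (\<theta> m1)) \<otimes>\<^bsub>I\<^esub> \<xi> m2 (\<theta> m2) \<and>
       h (m1, m2) = \<xi> (circ M m1 m2)
                      (inv\<^bsub>I\<^esub> (\<theta> (circ M m1 m2)) \<otimes>\<^bsub>I\<^esub> \<epsilon> m2 (\<theta> m1) \<otimes>\<^bsub>I\<^esub> \<theta> m2)}"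

definition H2_N ::
  "'m skew_brace \<Rightarrow> 'i skew_brace \<Rightarrow> ('m \<Rightarrow> 'i \<Rightarrow> 'i) \<Rightarrow> ('m \<Rightarrow> 'i \<Rightarrow> 'i) \<Rightarrow> ('m \<Rightarrow> 'i \<Rightarrow> 'i)
     \<Rightarrow> (('m \<times> 'm \<Rightarrow> 'i) \<times> ('m \<times> 'm \<Rightarrow> 'i)) set monoid" where
  "H2_N M I \<xi> \<zeta> \<epsilon> = Z2_N M I \<xi> \<zeta> \<epsilon> Mod B2_N M I \<xi> \<zeta> \<epsilon>"

text \<open>The actions on \<open>K\<^sub>S\<close> induced by \<open>(\<nu>, \<mu>, \<sigma>, f)\<close>; \<open>\<zeta>\<close> is \<open>\<mu>\<close> itself.\<close>

definition xi_action :: "('a, 'b) rrb \<Rightarrow> ('b \<Rightarrow> 'k \<Rightarrow> 'k) \<Rightarrow> 'a \<Rightarrow> 'k \<Rightarrow> 'k" where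
  "xi_action A \<nu> a = \<nu> (rrb_op A a)"

definition epsilon_action ::
  "('a, 'b) rrb \<Rightarrow> ('k, 'l) rrb \<Rightarrow> ('b \<Rightarrow> 'k \<Rightarrow> 'k) \<Rightarrow> ('a \<Rightarrow> 'k \<Rightarrow> 'k)
     \<Rightarrow> ('l \<Rightarrow> 'a \<Rightarrow> 'k) \<Rightarrow> 'a \<Rightarrow> 'k \<Rightarrow> 'k" where
  "epsilon_action A K \<nu> \<mu> f a k =
     \<mu> (rrb_act A (inv\<^bsub>rrb_G A\<^esub> (rrb_op A a)) a) (\<nu> (inv\<^bsub>rrb_G A\<^esub> (rrb_op A a)) k) \<otimes>\<^bsub>rrb_H K\<^esub>
     \<nu> (inv\<^bsub>rrb_G A\<^esub> (rrb_op A a)) (f (rrb_op K k) a)"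


section \<open>The maps \<open>\<Psi>\<close>, \<open>\<Pi>\<close> and \<open>\<Lambda>\<close>\<close>

definition cocycle_ext ::
  "('a, 'b) rrb \<Rightarrow> ('k, 'l) rrb \<Rightarrow> ('b \<Rightarrow> 'k \<Rightarrow> 'k) \<Rightarrow> ('a \<Rightarrow> 'k \<Rightarrow> 'k)
     \<Rightarrow> ('b \<Rightarrow> 'l \<Rightarrow> 'l) \<Rightarrow> ('l \<Rightarrow> 'a \<Rightarrow> 'k) \<Rightarrow> ('a, 'b, 'k, 'l) cochain2_RRB
     \<Rightarrow> ('k, 'l, 'a \<times> 'k, 'b \<times> 'l, 'a, 'b) rrb_ext" where
  "cocycle_ext A K \<nu> \<mu> \<sigma> f = (\<lambda>(\<tau>1, \<tau>2, \<rho>, \<chi>).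
     \<lparr>ext_mid =
        \<lparr>rrb_H =
           \<lparr>carrier = carrier (rrb_H A) \<times> carrier (rrb_H K),
            mult = (\<lambda>(a1, k1) (a2, k2).
              (a1 \<otimes>\<^bsub>rrb_H A\<^esub> a2, \<mu> a2 k1 \<otimes>\<^bsub>rrb_H K\<^esub> k2 \<otimes>\<^bsub>rrb_H K\<^esub> \<tau>1 (a1, a2))),
            one = (\<one>\<^bsub>rrb_H A\<^esub>, \<one>\<^bsub>rrb_H K\<^esub>)\<rparr>,
         rrb_G =
           \<lparr>carrier = carrier (rrb_G A) \<times> carrier (rrb_G K),
            mult = (\<lambda>(b1, l1) (b2, l2).
              (b1 \<otimes>\<^bsub>rrb_G A\<^esub> b2, \<sigma> b2 l1 \<otimes>\<^bsub>rrb_G K\<^esub> l2 \<otimes>\<^bsub>rrb_G K\<^esub> \<tau>2 (b1, b2))),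
            one = (\<one>\<^bsub>rrb_G A\<^esub>, \<one>\<^bsub>rrb_G K\<^esub>)\<rparr>,
         rrb_act = (\<lambda>(b, l). \<lambda>(a, k)\<in>carrier (rrb_H A) \<times> carrier (rrb_H K).
           (rrb_act A b a, \<rho> (a, b) \<otimes>\<^bsub>rrb_H K\<^esub> \<nu> b (f l a \<otimes>\<^bsub>rrb_H K\<^esub> k))),
         rrb_op = (\<lambda>(a, k).
           (rrb_op A a,
            \<chi> a \<otimes>\<^bsub>rrb_G K\<^esub>
            rrb_op K ((inv\<^bsub>AutoGroup (rrb_H K)\<^esub> (\<nu> (rrb_op A a))) k)))\<rparr>,
      ext_i1 = (\<lambda>k. (\<one>\<^bsub>rrb_H A\<^esub>, k)),
      ext_i2 = (\<lambda>l. (\<one>\<^bsub>rrb_G A\<^esub>, l)),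
      ext_p1 = fst,
      ext_p2 = fst\<rparr>)"

text \<open>
  Each of the following maps is defined on a class through representatives: \<^const>\<open>the_elem\<close>
  extracts the value common to all representatives, and is unspecified if there is none.
\<close>

definition Psi ::
  "('a, 'b) rrb \<Rightarrow> ('k, 'l) rrb \<Rightarrow> ('b \<Rightarrow> 'k \<Rightarrow> 'k) \<Rightarrow> ('a \<Rightarrow> 'k \<Rightarrow> 'k)
     \<Rightarrow> ('b \<Rightarrow> 'l \<Rightarrow> 'l) \<Rightarrow> ('l \<Rightarrow> 'a \<Rightarrow> 'k) \<Rightarrow> ('a, 'b, 'k, 'l) cochain2_RRB set
     \<Rightarrow> ('k, 'l, 'a \<times> 'k, 'b \<times> 'l, 'a, 'b) rrb_ext set" where
  "Psi A K \<nu> \<mu> \<sigma> f c =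
     the_elem ((\<lambda>z. rrb_ext_class A K (cocycle_ext A K \<nu> \<mu> \<sigma> f z)) ` c)"

definition Pi_map ::
  "('a, 'b) rrb \<Rightarrow> ('k, 'l) rrb \<Rightarrow> ('k, 'l, 'h, 'g, 'a, 'b) rrb_ext set
     \<Rightarrow> ('k, 'h, 'a) brace_ext set" where
  "Pi_map A K C =
     the_elem ((\<lambda>E. brace_ext_class (induced_brace A) (induced_brace K) (induced_brace_ext E)) ` C)"

definition normalized_section ::
  "'m skew_brace \<Rightarrow> ('i, 'e, 'm) brace_ext \<Rightarrow> ('m \<Rightarrow> 'e) \<Rightarrow> bool" where
  "normalized_section M E s \<longleftrightarrow>
     s \<in> carrier M \<rightarrow> carrier (bext_mid E) \<and>
     (\<forall>m\<in>carrier M. bext_p E (s m) = m) \<and> s \<one>\<^bsub>M\<^esub> = \<one>\<^bsub>bext_mid E\<^esub>"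

definition section_cocycle ::
  "'m skew_brace \<Rightarrow> 'i skew_brace \<Rightarrow> ('i, 'e, 'm) brace_ext \<Rightarrow> ('m \<Rightarrow> 'e)
     \<Rightarrow> ('m \<times> 'm \<Rightarrow> 'i) \<times> ('m \<times> 'm \<Rightarrow> 'i)" where
  "section_cocycle M I E s =
     ((\<lambda>(m1, m2)\<in>carrier M \<times> carrier M.
         inv_into (carrier I) (bext_i E)
           (inv\<^bsub>bext_mid E\<^esub> (s (m1 \<otimes>\<^bsub>M\<^esub> m2)) \<otimes>\<^bsub>bext_mid E\<^esub>
            (s m1 \<otimes>\<^bsub>bext_mid E\<^esub> s m2))),
      (\<lambda>(m1, m2)\<in>carrier M \<times> carrier M.
         inv_into (carrier I) (bext_i E)
           (inv\<^bsub>bext_mid E\<^esub> (s (circ M m1 m2)) \<otimes>\<^bsub>bext_mid E\<^esub>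
            circ (bext_mid E) (s m1) (s m2))))"

definition Lambda ::
  "'m skew_brace \<Rightarrow> 'i skew_brace \<Rightarrow> ('m \<Rightarrow> 'i \<Rightarrow> 'i) \<Rightarrow> ('m \<Rightarrow> 'i \<Rightarrow> 'i) \<Rightarrow> ('m \<Rightarrow> 'i \<Rightarrow> 'i)
     \<Rightarrow> ('i, 'e, 'm) brace_ext set \<Rightarrow> (('m \<times> 'm \<Rightarrow> 'i) \<times> ('m \<times> 'm \<Rightarrow> 'i)) set" where
  "Lambda M I \<xi> \<zeta> \<epsilon> C =
     the_elem {B2_N M I \<xi> \<zeta> \<epsilon> #>\<^bsub>Z2_N M I \<xi> \<zeta> \<epsilon>\<^esub> section_cocycle M I E s | E s.
                 E \<in> C \<and> normalized_section M E s}"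

end

theory Submission
  imports Defs
begin

text \<open>
  On cocycles the map is \<open>(\<tau>\<^sub>1, \<tau>\<^sub>2, \<rho>, \<chi>) \<mapsto> (\<tau>\<^sub>1, h)\<close>, the cocycle of the section \<open>a \<mapsto> (a, 1)\<close> of
  \<open>A \<times> K\<close>, and it is visibly multiplicative. It takes values in cocycles because \<open>A \<times> K\<close> is a skew left
  brace. Multiplying a cocycle by the coboundary of \<open>(\<theta>\<^sub>1, \<theta>\<^sub>2)\<close> changes the extension by the isomorphism
  \<open>(a, k) \<mapsto> (a, k \<theta>\<^sub>1(a))\<close>, \<open>(b, l) \<mapsto> (b, l \<theta>\<^sub>2(b))\<close>; on braces it changes the section by \<open>\<theta>\<^sub>1\<close>, which is
  the coboundary of \<open>a \<mapsto> \<nu>\<^bsub>T(a)\<^esub>\<^sup>-\<^sup>1(\<theta>\<^sub>1(a))\<close>. So all three maps are well defined on classes.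
\<close>

text \<open>The theorem asserts more than multiplicativity: both quotients must be groups, and the
  composite is built from \<open>the_elem\<close>, so it has a usable value on a class only once all
  representatives are known to agree. For \<open>Lambda\<close> the representatives vary twice, over
  equivalent extensions and over sections. The first variation is harmless, since a section carried
  along an equivalence keeps its cocycle; only the second one produces a coboundary. The twist by
  the inverse of \<nu> (T a) in that coboundary is forced by \<open>B2_N\<close>, which writes a
  change of section as \<xi> at a applied to \<theta> (a). Deriving the brace conditions straight
  from \<open>Z2_RRB\<close> would mix its five conditions in long products of \<rho>, \<chi>,
  \<tau>1 and \<tau>2. Building the extension first separates them: each condition is used for
  exactly one axiom of a relative Rota-Baxter group.\<close>

section \<open>Calculations in commutative groups\<close>

text \<open>
  An opaque quotient lets the simplifier clear denominators as in a field: an identity between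
  products of elements and inverses becomes one between products, which the AC rules decide.
\<close>

definition (in comm_group) quot :: "'a \<Rightarrow> 'a \<Rightarrow> 'a" where
  "quot x y = x \<otimes> inv y"

context comm_group
begin

lemma inv_eq_quot: "x \<in> carrier G \<Longrightarrow> inv x = quot \<one> x"
  by (simp add: quot_def)

lemma quot_closed [simp]: "x \<in> carrier G \<Longrightarrow> y \<in> carrier G \<Longrightarrow> quot x y \<in> carrier G"
  by (simp add: quot_def)

lemma mult_quot_left:
  "x \<in> carrier G \<Longrightarrow> y \<in> carrier G \<Longrightarrow> z \<in> carrier G \<Longrightarrow> x \<otimes> quot y z = quot (x \<otimes> y) z"
  by (simp add: quot_def m_assoc)

lemma mult_quot_right:
  "x \<in> carrier G \<Longrightarrow> y \<in> carrier G \<Longrightarrow> z \<in> carrier G \<Longrightarrow> quot y z \<otimes> x = quot (x \<otimes> y) z"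
  by (simp add: quot_def m_ac)

lemma quot_quot_left:
  "x \<in> carrier G \<Longrightarrow> y \<in> carrier G \<Longrightarrow> z \<in> carrier G \<Longrightarrow> quot (quot x y) z = quot x (y \<otimes> z)"
  by (simp add: quot_def inv_mult m_ac)

lemma quot_quot_right:
  "x \<in> carrier G \<Longrightarrow> y \<in> carrier G \<Longrightarrow> z \<in> carrier G \<Longrightarrow> quot x (quot y z) = quot (x \<otimes> z) y"
  by (simp add: quot_def inv_mult m_ac)

lemma quot_eq_iff:
  "x \<in> carrier G \<Longrightarrow> y \<in> carrier G \<Longrightarrow> z \<in> carrier G \<Longrightarrow> quot x y = z \<longleftrightarrow> x = z \<otimes> y"
  unfolding quot_def by (metis inv_solve_right')

lemma eq_quot_iff:
  "x \<in> carrier G \<Longrightarrow> y \<in> carrier G \<Longrightarrow> z \<in> carrier G \<Longrightarrow> z = quot x y \<longleftrightarrow> z \<otimes> y = x"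
  unfolding quot_def by (metis inv_solve_right)

lemmas quot_simps =
  inv_eq_quot mult_quot_left mult_quot_right quot_quot_left quot_quot_right quot_eq_iff eq_quot_iff

text \<open>Lets an identity \<open>l = r\<close> be used inside a product without isolating the factors of \<open>l\<close> there.\<close>

lemma eq_by_multiple:
  assumes "l = r" "l \<in> carrier G" "x \<in> carrier G" "y \<in> carrier G" "x \<otimes> r = y \<otimes> l"
  shows "x = y"
  using assms by simp

end

section \<open>Direct products, subgroups and factor groups\<close>

lemma comm_group_DirProd:
  assumes "comm_group G" "comm_group H"
  shows "comm_group (G \<times>\<times> H)"
proof -
  interpret G: comm_group G by fact
  interpret H: comm_group H by fact
  show ?thesis
    by (rule group.group_comm_groupI[OF DirProd_group])
      (auto simp: G.group_axioms H.group_axioms G.m_comm H.m_comm)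
qed

lemma (in comm_group) comm_group_subgroup:
  assumes "subgroup S G"
  shows "comm_group (G\<lparr>carrier := S\<rparr>)"
  using assms subgroup.subgroup_is_group[OF assms group_axioms] subgroup.mem_carrier[OF assms]
  by (intro group.group_comm_groupI) (auto simp: m_comm)

text \<open>Here \<Phi> is given beforehand instead of being induced by \<open>F\<close>, because
  the composite in the theorem is built from \<open>the_elem\<close>. Its agreement with
  \<open>F\<close> on every representative contains well-definedness, and cosets are multiplied on
  representatives.\<close>

lemma group_hom_FactGroup:
  assumes "N \<lhd> G" "M \<lhd> H" and F: "F \<in> hom G H" and NM: "F ` N \<subseteq> M"
    and \<Phi>: "\<And>x. x \<in> carrier G \<Longrightarrow> \<Phi> (N #>\<^bsub>G\<^esub> x) = M #>\<^bsub>H\<^esub> F x"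
  shows "group_hom (G Mod N) (H Mod M) \<Phi>"
proof -
  interpret N: normal N G by fact
  interpret M: normal M H by fact
  have "\<Phi> \<in> hom (G Mod N) (H Mod M)"
  proof (rule homI)
    fix X assume "X \<in> carrier (G Mod N)"
    then show "\<Phi> X \<in> carrier (H Mod M)"
      using F by (auto simp: carrier_FactGroup \<Phi> hom_def)
  next
    fix X Y assume "X \<in> carrier (G Mod N)" "Y \<in> carrier (G Mod N)"
    then obtain x y where xy: "x \<in> carrier G" "X = N #>\<^bsub>G\<^esub> x" "y \<in> carrier G" "Y = N #>\<^bsub>G\<^esub> y"
      by (auto simp: carrier_FactGroup)
    moreover have "F x \<in> carrier H" "F y \<in> carrier H" "F (x \<otimes>\<^bsub>G\<^esub> y) = F x \<otimes>\<^bsub>H\<^esub> F y"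
      using F xy by (auto simp: hom_def)
    ultimately show "\<Phi> (X \<otimes>\<^bsub>G Mod N\<^esub> Y) = \<Phi> X \<otimes>\<^bsub>H Mod M\<^esub> \<Phi> Y"
      by (simp add: N.rcos_sum M.rcos_sum \<Phi>)
  qed
  then show ?thesis
    by (simp add: group_hom_def group_hom_axioms_def N.factorgroup_is_group M.factorgroup_is_group)
qed

text \<open>This evaluates maps given through representatives. The element \<open>x\<close> rules
  out the empty image, on which \<open>the_elem\<close> is unspecified.\<close>

lemma the_elem_image_eq: "x \<in> X \<Longrightarrow> (\<And>y. y \<in> X \<Longrightarrow> g y = c) \<Longrightarrow> the_elem (g ` X) = c"
  by (metis image_cong image_constant the_elem_eq)

section \<open>Cochain groups\<close>

lemma restrict_eq_restrict_iff: "restrict g D = restrict g' D \<longleftrightarrow> (\<forall>x\<in>D. g x = g' x)"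
  by (metis restrict_apply restrict_ext)

lemma carrier_cochain_group:
  "carrier (cochain_group D N Y) = {c \<in> D \<rightarrow>\<^sub>E carrier Y. \<forall>x\<in>D \<inter> N. c x = \<one>\<^bsub>Y\<^esub>}"
  by (simp add: cochain_group_def)

lemma mult_cochain_group [simp]:
  "mult (cochain_group D N Y) = (\<lambda>c c'. \<lambda>x\<in>D. c x \<otimes>\<^bsub>Y\<^esub> c' x)"
  by (simp add: cochain_group_def)

lemma one_cochain_group [simp]: "one (cochain_group D N Y) = (\<lambda>x\<in>D. \<one>\<^bsub>Y\<^esub>)"
  by (simp add: cochain_group_def)

lemma comm_group_cochain_group:
  assumes "comm_group Y"
  shows "comm_group (cochain_group D N Y)"
proof -
  interpret Y: comm_group Y by fact
  note [simp] = carrier_cochain_group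
  show ?thesis
  proof (rule comm_groupI)
    fix c assume c: "c \<in> carrier (cochain_group D N Y)"
    then show "\<one>\<^bsub>cochain_group D N Y\<^esub> \<otimes>\<^bsub>cochain_group D N Y\<^esub> c = c"
      by (auto simp: fun_eq_iff PiE_iff extensional_def)
    show "\<exists>c'\<in>carrier (cochain_group D N Y). c' \<otimes>\<^bsub>cochain_group D N Y\<^esub> c = \<one>\<^bsub>cochain_group D N Y\<^esub>"
      using c by (intro bexI[of _ "\<lambda>x\<in>D. inv\<^bsub>Y\<^esub> c x"])
        (auto simp: fun_eq_iff PiE_iff Y.l_inv)
  qed (auto simp: fun_eq_iff PiE_iff Y.m_assoc intro: Y.m_comm)
qed

lemma mult_cochains1 [simp]:
  "mult (cochains1 X Y) = (\<lambda>c c'. \<lambda>x\<in>carrier X. c x \<otimes>\<^bsub>Y\<^esub> c' x)"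
  by (simp add: cochains1_def)

lemma mult_cochains2 [simp]:
  "mult (cochains2 X1 X2 Y) = (\<lambda>c c'. \<lambda>x\<in>carrier X1 \<times> carrier X2. c x \<otimes>\<^bsub>Y\<^esub> c' x)"
  by (simp add: cochains2_def)

lemma one_cochains2 [simp]: "one (cochains2 X1 X2 Y) = (\<lambda>x\<in>carrier X1 \<times> carrier X2. \<one>\<^bsub>Y\<^esub>)"
  by (simp add: cochains2_def)

lemma one_cochains3 [simp]:
  "one (cochains3 X1 X2 X3 Y) = (\<lambda>x\<in>carrier X1 \<times> carrier X2 \<times> carrier X3. \<one>\<^bsub>Y\<^esub>)"
  by (simp add: cochains3_def)

lemma cochains1_iff:
  "\<one>\<^bsub>X\<^esub> \<in> carrier X \<Longrightarrow> c \<in> carrier (cochains1 X Y) \<longleftrightarrow>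
     c \<in> carrier X \<rightarrow>\<^sub>E carrier Y \<and> c \<one>\<^bsub>X\<^esub> = \<one>\<^bsub>Y\<^esub>"
  by (auto simp: cochains1_def carrier_cochain_group)

lemma cochains2_iff:
  "\<one>\<^bsub>X1\<^esub> \<in> carrier X1 \<Longrightarrow> \<one>\<^bsub>X2\<^esub> \<in> carrier X2 \<Longrightarrow> c \<in> carrier (cochains2 X1 X2 Y) \<longleftrightarrow>
     c \<in> carrier X1 \<times> carrier X2 \<rightarrow>\<^sub>E carrier Y \<and>
     (\<forall>x\<in>carrier X2. c (\<one>\<^bsub>X1\<^esub>, x) = \<one>\<^bsub>Y\<^esub>) \<and> (\<forall>x\<in>carrier X1. c (x, \<one>\<^bsub>X2\<^esub>) = \<one>\<^bsub>Y\<^esub>)"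
  by (auto simp: cochains2_def carrier_cochain_group)

lemma comm_group_cochains1: "comm_group Y \<Longrightarrow> comm_group (cochains1 X Y)"
  by (simp add: cochains1_def comm_group_cochain_group)

lemma comm_group_cochains2: "comm_group Y \<Longrightarrow> comm_group (cochains2 X1 X2 Y)"
  by (simp add: cochains2_def comm_group_cochain_group)

section \<open>The skew left brace of a relative Rota-Baxter group\<close>

lemma induced_brace_simps [simp]:
  "carrier (induced_brace X) = carrier (rrb_H X)"
  "mult (induced_brace X) = mult (rrb_H X)"
  "one (induced_brace X) = one (rrb_H X)"
  "circ (induced_brace X) x y = x \<otimes>\<^bsub>rrb_H X\<^esub> rrb_act X (rrb_op X x) y"
  by (simp_all add: induced_brace_def)

lemma circ_group_simps [simp]:
  "carrier (circ_group M) = carrier M" "mult (circ_group M) = circ M" "one (circ_group M) = one M"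
  by (simp_all add: circ_group_def)

text \<open>Inverses, homomorphisms, automorphisms and cochains depend only on carrier,
  multiplication and unit. The field \<open>circ\<close> therefore drops out, and all calculations
  take place in \<open>rrb_H X\<close>.\<close>

lemma inv_induced_brace [simp]: "inv\<^bsub>induced_brace X\<^esub> x = inv\<^bsub>rrb_H X\<^esub> x"
  by (simp add: m_inv_def)

lemma hom_induced_brace [simp]:
  "hom (induced_brace X) Y = hom (rrb_H X) Y" "hom Z (induced_brace X) = hom Z (rrb_H X)"
  by (simp_all add: hom_def)

lemma AutoGroup_induced_brace [simp]: "AutoGroup (induced_brace X) = AutoGroup (rrb_H X)"
  by (simp add: AutoGroup_def auto_def)

lemma cochains2_induced_brace [simp]:
  "cochains2 (induced_brace X) (induced_brace X) (induced_brace Y)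
     = cochains2 (rrb_H X) (rrb_H X) (rrb_H Y)"
  by (simp add: cochains2_def cochain_group_def product_group_def)

section \<open>Groups acting by automorphisms\<close>

lemma AutoGroup_simps:
  "carrier (AutoGroup G) = auto G" "\<one>\<^bsub>AutoGroup G\<^esub> = (\<lambda>x\<in>carrier G. x)"
  by (simp_all add: AutoGroup_def BijGroup_def)

lemma mult_AutoGroup:
  "x \<in> auto G \<Longrightarrow> y \<in> auto G \<Longrightarrow> x \<otimes>\<^bsub>AutoGroup G\<^esub> y = compose (carrier G) x y"
  by (simp add: AutoGroup_def BijGroup_def auto_def)

context group
begin

lemma auto_closed: "h \<in> auto G \<Longrightarrow> x \<in> carrier G \<Longrightarrow> h x \<in> carrier G"
  by (auto simp: auto_def hom_def)

lemma auto_mult: "h \<in> auto G \<Longrightarrow> x \<in> carrier G \<Longrightarrow> y \<in> carrier G \<Longrightarrow> h (x \<otimes> y) = h x \<otimes> h y"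
  by (auto simp: auto_def hom_def)

lemma auto_group_hom: "h \<in> auto G \<Longrightarrow> group_hom G G h"
  by (auto simp: auto_def group_hom_def group_hom_axioms_def group_axioms)

lemma auto_one: "h \<in> auto G \<Longrightarrow> h \<one> = \<one>"
  by (rule group_hom.hom_one[OF auto_group_hom])

lemma auto_inv: "h \<in> auto G \<Longrightarrow> x \<in> carrier G \<Longrightarrow> h (inv x) = inv (h x)"
  by (rule group_hom.hom_inv[OF auto_group_hom])

lemma autoI:
  assumes "h \<in> extensional (carrier G)"
    and "\<And>x. x \<in> carrier G \<Longrightarrow> h x \<in> carrier G"
    and "\<And>x y. x \<in> carrier G \<Longrightarrow> y \<in> carrier G \<Longrightarrow> h (x \<otimes> y) = h x \<otimes> h y"
    and "\<And>x. x \<in> carrier G \<Longrightarrow> h' x \<in> carrier G"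
    and "\<And>x. x \<in> carrier G \<Longrightarrow> h (h' x) = x" and "\<And>x. x \<in> carrier G \<Longrightarrow> h' (h x) = x"
  shows "h \<in> auto G"
proof -
  have "bij_betw h (carrier G) (carrier G)"
    using assms(2,4-6) by (intro bij_betwI[of _ _ _ h']) auto
  then show ?thesis
    using assms(1-3) by (simp add: auto_def hom_def Bij_def)
qed

end

text \<open>The definitions invert \<nu> b inside \<open>AutoGroup\<close>. The last equation
  replaces this by \<nu> at an inverse argument, so that a single form of the inverse action
  remains.\<close>

lemma hom_AutoGroup:
  assumes "group P" "group G" and \<phi>: "\<phi> \<in> hom P (AutoGroup G)"
  shows "p \<in> carrier P \<Longrightarrow> \<phi> p \<in> auto G"
    and "p \<in> carrier P \<Longrightarrow> q \<in> carrier P \<Longrightarrow> x \<in> carrier G \<Longrightarrow> \<phi> (p \<otimes>\<^bsub>P\<^esub> q) x = \<phi> p (\<phi> q x)"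
    and "x \<in> carrier G \<Longrightarrow> \<phi> \<one>\<^bsub>P\<^esub> x = x"
    and "p \<in> carrier P \<Longrightarrow> inv\<^bsub>AutoGroup G\<^esub> (\<phi> p) = \<phi> (inv\<^bsub>P\<^esub> p)"
proof -
  interpret P: group P by fact
  interpret G: group G by fact
  interpret h: group_hom P "AutoGroup G" \<phi>
    using \<phi> by (simp add: group_hom_def group_hom_axioms_def G.AutoGroup P.group_axioms)
  show au: "p \<in> carrier P \<Longrightarrow> \<phi> p \<in> auto G" for p
    using h.hom_closed by (simp add: AutoGroup_simps)
  show "p \<in> carrier P \<Longrightarrow> q \<in> carrier P \<Longrightarrow> x \<in> carrier G \<Longrightarrow> \<phi> (p \<otimes>\<^bsub>P\<^esub> q) x = \<phi> p (\<phi> q x)"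
    by (simp add: h.hom_mult mult_AutoGroup au compose_def)
  show "x \<in> carrier G \<Longrightarrow> \<phi> \<one>\<^bsub>P\<^esub> x = x"
    by (simp add: h.hom_one AutoGroup_simps)
  show "p \<in> carrier P \<Longrightarrow> inv\<^bsub>AutoGroup G\<^esub> (\<phi> p) = \<phi> (inv\<^bsub>P\<^esub> p)"
    by simp
qed

lemma antihom_AutoGroup:
  assumes "group P" "group G" and \<phi>: "\<phi> \<in> antihom P (AutoGroup G)"
  shows "p \<in> carrier P \<Longrightarrow> \<phi> p \<in> auto G"
    and "p \<in> carrier P \<Longrightarrow> q \<in> carrier P \<Longrightarrow> x \<in> carrier G \<Longrightarrow> \<phi> (p \<otimes>\<^bsub>P\<^esub> q) x = \<phi> q (\<phi> p x)"
    and "x \<in> carrier G \<Longrightarrow> \<phi> \<one>\<^bsub>P\<^esub> x = x"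
proof -
  interpret P: group P by fact
  interpret G: group G by fact
  interpret U: group "AutoGroup G" by (rule G.AutoGroup)
  show au: "p \<in> carrier P \<Longrightarrow> \<phi> p \<in> auto G" for p
    using \<phi> by (auto simp: antihom_def AutoGroup_simps)
  show "p \<in> carrier P \<Longrightarrow> q \<in> carrier P \<Longrightarrow> x \<in> carrier G \<Longrightarrow> \<phi> (p \<otimes>\<^bsub>P\<^esub> q) x = \<phi> q (\<phi> p x)"
    using \<phi> by (simp add: antihom_def mult_AutoGroup au compose_def)
  \<comment> \<open>The homomorphism lemmas do not apply to an antihomomorphism. The image of the
    unit is idempotent, hence the unit of the automorphism group.\<close>
  have "\<phi> (\<one>\<^bsub>P\<^esub> \<otimes>\<^bsub>P\<^esub> \<one>\<^bsub>P\<^esub>) = \<phi> \<one>\<^bsub>P\<^esub> \<otimes>\<^bsub>AutoGroup G\<^esub> \<phi> \<one>\<^bsub>P\<^esub>"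
    using \<phi> P.one_closed unfolding antihom_def by blast
  then have "\<phi> \<one>\<^bsub>P\<^esub> \<otimes>\<^bsub>AutoGroup G\<^esub> \<phi> \<one>\<^bsub>P\<^esub> = \<phi> \<one>\<^bsub>P\<^esub>"
    by simp
  then have "\<phi> \<one>\<^bsub>P\<^esub> = \<one>\<^bsub>AutoGroup G\<^esub>"
    using au[OF P.one_closed] U.l_cancel_one by (simp add: AutoGroup_simps(1))
  then show "x \<in> carrier G \<Longrightarrow> \<phi> \<one>\<^bsub>P\<^esub> x = x"
    by (simp add: AutoGroup_simps)
qed

text \<open>Bijectivity need not be supplied: by \<open>comp\<close> and \<open>unit\<close>, the
  map \<phi> at the inverse of p is a two-sided inverse of \<phi> p.\<close>

lemma hom_AutoGroupI:
  assumes "group P" "group G"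
    and ext: "\<And>p. p \<in> carrier P \<Longrightarrow> \<phi> p \<in> extensional (carrier G)"
    and closed: "\<And>p x. p \<in> carrier P \<Longrightarrow> x \<in> carrier G \<Longrightarrow> \<phi> p x \<in> carrier G"
    and mult: "\<And>p x y. p \<in> carrier P \<Longrightarrow> x \<in> carrier G \<Longrightarrow> y \<in> carrier G \<Longrightarrow>
      \<phi> p (x \<otimes>\<^bsub>G\<^esub> y) = \<phi> p x \<otimes>\<^bsub>G\<^esub> \<phi> p y"
    and comp: "\<And>p q x. p \<in> carrier P \<Longrightarrow> q \<in> carrier P \<Longrightarrow> x \<in> carrier G \<Longrightarrow>
      \<phi> (p \<otimes>\<^bsub>P\<^esub> q) x = \<phi> p (\<phi> q x)"
    and unit: "\<And>x. x \<in> carrier G \<Longrightarrow> \<phi> \<one>\<^bsub>P\<^esub> x = x"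
  shows "\<phi> \<in> hom P (AutoGroup G)"
proof -
  interpret P: group P by fact
  interpret G: group G by fact
  have au: "\<phi> p \<in> auto G" if "p \<in> carrier P" for p
    using that ext closed mult by (intro G.autoI[of _ "\<phi> (inv\<^bsub>P\<^esub> p)"]) (simp_all add: unit flip: comp)
  moreover have "\<phi> (p \<otimes>\<^bsub>P\<^esub> q) = \<phi> p \<otimes>\<^bsub>AutoGroup G\<^esub> \<phi> q" if "p \<in> carrier P" "q \<in> carrier P" for p q
    using ext[of "p \<otimes>\<^bsub>P\<^esub> q"] that comp[OF that]
    by (auto simp: mult_AutoGroup au compose_def fun_eq_iff extensional_def)
  ultimately show ?thesis
    by (auto simp: hom_def AutoGroup_simps)
qed

text \<open>The action is written on the right: \<open>k1\<close> is moved past \<open>a2\<close>,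
  so \<alpha> reverses products. The cocycle identity is then associativity.\<close>

lemma group_cocycle_extension:
  assumes "group P" "comm_group Q" and \<alpha>: "\<alpha> \<in> antihom P (AutoGroup Q)"
    and \<tau>: "\<tau> \<in> carrier P \<times> carrier P \<rightarrow> carrier Q"
    and unit: "\<And>p. p \<in> carrier P \<Longrightarrow> \<tau> (\<one>\<^bsub>P\<^esub>, p) = \<one>\<^bsub>Q\<^esub>"
    and cocycle: "\<And>p q r. p \<in> carrier P \<Longrightarrow> q \<in> carrier P \<Longrightarrow> r \<in> carrier P \<Longrightarrow>
      \<tau> (q, r) \<otimes>\<^bsub>Q\<^esub> \<tau> (p, q \<otimes>\<^bsub>P\<^esub> r) = \<tau> (p \<otimes>\<^bsub>P\<^esub> q, r) \<otimes>\<^bsub>Q\<^esub> \<alpha> r (\<tau> (p, q))"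
  shows "group \<lparr>carrier = carrier P \<times> carrier Q,
    mult = (\<lambda>(a1, k1) (a2, k2). (a1 \<otimes>\<^bsub>P\<^esub> a2, \<alpha> a2 k1 \<otimes>\<^bsub>Q\<^esub> k2 \<otimes>\<^bsub>Q\<^esub> \<tau> (a1, a2))),
    one = (\<one>\<^bsub>P\<^esub>, \<one>\<^bsub>Q\<^esub>)\<rparr>" (is "group ?E")
proof -
  interpret P: group P by fact
  interpret Q: comm_group Q by fact
  note [simp] = antihom_AutoGroup(2-3)[OF P.group_axioms Q.group_axioms \<alpha>] unit
  note au = antihom_AutoGroup(1)[OF P.group_axioms Q.group_axioms \<alpha>]
  note [simp] = Q.auto_closed[OF au] Q.auto_mult[OF au] Q.auto_one[OF au] Q.auto_inv[OF au]
  have [simp]: "p \<in> carrier P \<Longrightarrow> q \<in> carrier P \<Longrightarrow> \<tau> (p, q) \<in> carrier Q" for p q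
    using \<tau> by auto
  show ?thesis
  proof (rule groupI)
    fix x y z assume "x \<in> carrier ?E" "y \<in> carrier ?E" "z \<in> carrier ?E"
    then obtain p k q l r m where x: "x = (p, k)" "y = (q, l)" "z = (r, m)"
      "p \<in> carrier P" "q \<in> carrier P" "r \<in> carrier P" "k \<in> carrier Q" "l \<in> carrier Q" "m \<in> carrier Q"
      by auto
    \<comment> \<open>AC rewriting scatters the factors of the cocycle identity among others. The
      extra factor u makes the identity applicable at the head of a longer product.\<close>
    have "\<tau> (p \<otimes>\<^bsub>P\<^esub> q, r) \<otimes>\<^bsub>Q\<^esub> (\<alpha> r (\<tau> (p, q)) \<otimes>\<^bsub>Q\<^esub> u) = \<tau> (q, r) \<otimes>\<^bsub>Q\<^esub> (\<tau> (p, q \<otimes>\<^bsub>P\<^esub> r) \<otimes>\<^bsub>Q\<^esub> u)"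
      if "u \<in> carrier Q" for u
      using x that cocycle[of p q r] by (simp flip: Q.m_assoc)
    then show "x \<otimes>\<^bsub>?E\<^esub> y \<otimes>\<^bsub>?E\<^esub> z = x \<otimes>\<^bsub>?E\<^esub> (y \<otimes>\<^bsub>?E\<^esub> z)"
      using x by (simp add: P.m_assoc Q.m_ac)
  next
    fix x assume "x \<in> carrier ?E"
    then obtain p k where x: "x = (p, k)" "p \<in> carrier P" "k \<in> carrier Q" by auto
    \<comment> \<open>The second component solves \<alpha> p (u) * k * \<tau> (inv p, p) = 1 for
      u.\<close>
    let ?y = "(inv\<^bsub>P\<^esub> p, \<alpha> (inv\<^bsub>P\<^esub> p) (inv\<^bsub>Q\<^esub> (k \<otimes>\<^bsub>Q\<^esub> \<tau> (inv\<^bsub>P\<^esub> p, p))))"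
    have "\<alpha> p (\<alpha> (inv\<^bsub>P\<^esub> p) u) = u" if "u \<in> carrier Q" for u
      using x that by (simp flip: antihom_AutoGroup(2)[OF P.group_axioms Q.group_axioms \<alpha>])
    then have "?y \<otimes>\<^bsub>?E\<^esub> x = \<one>\<^bsub>?E\<^esub>"
      using x by (simp add: Q.m_assoc)
    then show "\<exists>y\<in>carrier ?E. y \<otimes>\<^bsub>?E\<^esub> x = \<one>\<^bsub>?E\<^esub>"
      using x by (intro bexI[of _ ?y]) simp_all
  qed auto
qed

locale rrb =
  fixes X :: "('h, 'g) rrb"
  assumes rrb: "rrb_group X"

sublocale rrb \<subseteq> H: group "rrb_H X" using rrb by (simp add: rrb_group_def)
sublocale rrb \<subseteq> G: group "rrb_G X" using rrb by (simp add: rrb_group_def)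

context rrb
begin

lemma act_hom: "rrb_act X \<in> hom (rrb_G X) (AutoGroup (rrb_H X))"
  using rrb by (simp add: rrb_group_def)

lemmas act_simps [simp] = hom_AutoGroup(2-3)[OF G.group_axioms H.group_axioms act_hom]
lemmas act_auto = hom_AutoGroup(1)[OF G.group_axioms H.group_axioms act_hom]

lemma act_closed [simp]:
  "g \<in> carrier (rrb_G X) \<Longrightarrow> x \<in> carrier (rrb_H X) \<Longrightarrow> rrb_act X g x \<in> carrier (rrb_H X)"
  using act_auto H.auto_closed by blast

lemma act_mult [simp]:
  "g \<in> carrier (rrb_G X) \<Longrightarrow> x \<in> carrier (rrb_H X) \<Longrightarrow> y \<in> carrier (rrb_H X) \<Longrightarrow>
     rrb_act X g (x \<otimes>\<^bsub>rrb_H X\<^esub> y) = rrb_act X g x \<otimes>\<^bsub>rrb_H X\<^esub> rrb_act X g y"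
  using act_auto H.auto_mult by blast

lemma act_one [simp]: "g \<in> carrier (rrb_G X) \<Longrightarrow> rrb_act X g \<one>\<^bsub>rrb_H X\<^esub> = \<one>\<^bsub>rrb_H X\<^esub>"
  using act_auto H.auto_one by blast

lemma act_inv_act [simp]:
  assumes "g \<in> carrier (rrb_G X)" "x \<in> carrier (rrb_H X)"
  shows "rrb_act X (inv\<^bsub>rrb_G X\<^esub> g) (rrb_act X g x) = x"
    and "rrb_act X g (rrb_act X (inv\<^bsub>rrb_G X\<^esub> g) x) = x"
  using assms by (simp_all flip: act_simps(1))

lemma op_closed [simp]: "x \<in> carrier (rrb_H X) \<Longrightarrow> rrb_op X x \<in> carrier (rrb_G X)"
  using rrb by (auto simp: rrb_group_def)

lemma op_circ [simp]:
  "x \<in> carrier (rrb_H X) \<Longrightarrow> y \<in> carrier (rrb_H X) \<Longrightarrow>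
     rrb_op X (x \<otimes>\<^bsub>rrb_H X\<^esub> rrb_act X (rrb_op X x) y) = rrb_op X x \<otimes>\<^bsub>rrb_G X\<^esub> rrb_op X y"
  using rrb by (simp add: rrb_group_def)

lemma op_one [simp]: "rrb_op X \<one>\<^bsub>rrb_H X\<^esub> = \<one>\<^bsub>rrb_G X\<^esub>"
  using op_circ[of "\<one>\<^bsub>rrb_H X\<^esub>" "\<one>\<^bsub>rrb_H X\<^esub>"] by simp

lemma circ_right_inverse:
  assumes x: "x \<in> carrier (rrb_H X)"
  defines "y \<equiv> rrb_act X (inv\<^bsub>rrb_G X\<^esub> rrb_op X x) (inv\<^bsub>rrb_H X\<^esub> x)"
  shows "x \<otimes>\<^bsub>rrb_H X\<^esub> rrb_act X (rrb_op X x) y = \<one>\<^bsub>rrb_H X\<^esub>"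
  using x by (simp add: y_def)

text \<open>This is the shape in which the simplifier meets the operator on a threefold circle
  product, once \<open>act_mult\<close> has distributed the outer action.\<close>

lemma op_circ_circ [simp]:
  assumes "x \<in> carrier (rrb_H X)" "y \<in> carrier (rrb_H X)" "z \<in> carrier (rrb_H X)"
  shows "rrb_op X (x \<otimes>\<^bsub>rrb_H X\<^esub> (rrb_act X (rrb_op X x) y \<otimes>\<^bsub>rrb_H X\<^esub> rrb_act X (rrb_op X x) (rrb_act X (rrb_op X y) z)))
      = rrb_op X x \<otimes>\<^bsub>rrb_G X\<^esub> (rrb_op X y \<otimes>\<^bsub>rrb_G X\<^esub> rrb_op X z)"
  using assms op_circ[of x "y \<otimes>\<^bsub>rrb_H X\<^esub> rrb_act X (rrb_op X y) z"] by simp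

text \<open>Associativity holds because the operator turns the circle product into the product of
  \<open>rrb_G X\<close>. It is stated with the operations of the relative Rota-Baxter group, so
  that it can later be evaluated at elements (x, 1) of an extension.\<close>

lemma circ_assoc:
  assumes "x \<in> carrier (rrb_H X)" "y \<in> carrier (rrb_H X)" "z \<in> carrier (rrb_H X)"
  shows "x \<otimes>\<^bsub>rrb_H X\<^esub> rrb_act X (rrb_op X x) (y \<otimes>\<^bsub>rrb_H X\<^esub> rrb_act X (rrb_op X y) z) =
    (x \<otimes>\<^bsub>rrb_H X\<^esub> rrb_act X (rrb_op X x) y) \<otimes>\<^bsub>rrb_H X\<^esub>
      rrb_act X (rrb_op X (x \<otimes>\<^bsub>rrb_H X\<^esub> rrb_act X (rrb_op X x) y)) z"
  using assms by (simp add: H.m_assoc)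

lemma circ_mult:
  assumes "x \<in> carrier (rrb_H X)" "y \<in> carrier (rrb_H X)" "z \<in> carrier (rrb_H X)"
  shows "x \<otimes>\<^bsub>rrb_H X\<^esub> rrb_act X (rrb_op X x) (y \<otimes>\<^bsub>rrb_H X\<^esub> z) =
      (x \<otimes>\<^bsub>rrb_H X\<^esub> rrb_act X (rrb_op X x) y) \<otimes>\<^bsub>rrb_H X\<^esub> inv\<^bsub>rrb_H X\<^esub> x \<otimes>\<^bsub>rrb_H X\<^esub>
      (x \<otimes>\<^bsub>rrb_H X\<^esub> rrb_act X (rrb_op X x) z)"
  using assms by (simp add: H.m_assoc) (simp flip: H.m_assoc)

lemma skew_left_brace_induced: "skew_left_brace (induced_brace X)"
proof -
  have "group (circ_group (induced_brace X))"
  proof (rule groupI)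
    fix x assume "x \<in> carrier (circ_group (induced_brace X))"
    then have x: "x \<in> carrier (rrb_H X)" by simp
    define y where "y = rrb_act X (inv\<^bsub>rrb_G X\<^esub> rrb_op X x) (inv\<^bsub>rrb_H X\<^esub> x)"
    have y: "y \<in> carrier (rrb_H X)" using x by (simp add: y_def)
    \<comment> \<open>So far y is a right inverse, while \<open>groupI\<close> asks for a left one.
      The operator sends y to the inverse of its value at x, so both factors of y circ x lie under
      the same automorphism, which leaves the image of inv x * x.\<close>
    have "rrb_op X x \<otimes>\<^bsub>rrb_G X\<^esub> rrb_op X y = \<one>\<^bsub>rrb_G X\<^esub>"
      using circ_right_inverse[OF x] op_circ[OF x y] by (simp add: y_def)
    then have "rrb_op X y = inv\<^bsub>rrb_G X\<^esub> rrb_op X x"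
      by (metis G.inv_equality G.inv_inv op_closed x y)
    then have "y \<otimes>\<^bsub>rrb_H X\<^esub> rrb_act X (rrb_op X y) x = \<one>\<^bsub>rrb_H X\<^esub>"
      using x by (simp add: y_def act_mult[symmetric] del: act_mult)
    with y show "\<exists>y\<in>carrier (circ_group (induced_brace X)).
        y \<otimes>\<^bsub>circ_group (induced_brace X)\<^esub> x = \<one>\<^bsub>circ_group (induced_brace X)\<^esub>"
      by auto
  qed (simp_all add: H.m_assoc)
  moreover have "group (induced_brace X)"
    by (rule groupI) (auto simp: H.m_assoc intro: H.l_inv)
  ultimately show ?thesis
    using circ_mult by (simp add: skew_left_brace_def)
qed

end

lemma skew_brace_hom_induced:
  assumes "(\<psi>, \<eta>) \<in> rrb_hom X Y" "rrb_group X"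
  shows "\<psi> \<in> skew_brace_hom (induced_brace X) (induced_brace Y)"
proof -
  interpret rrb X by unfold_locales fact
  have "rrb_op Y (\<psi> x) = \<eta> (rrb_op X x)"
    and "g \<in> carrier (rrb_G X) \<Longrightarrow> \<psi> (rrb_act X g x) = rrb_act Y (\<eta> g) (\<psi> x)"
    if "x \<in> carrier (rrb_H X)" for x g
    using assms(1) that by (auto simp: rrb_hom_def)
  moreover from assms(1) have "\<psi> \<in> hom (rrb_H X) (rrb_H Y)" by (auto simp: rrb_hom_def)
  ultimately show ?thesis
    by (auto simp: skew_brace_hom_def hom_def Pi_iff)
qed

lemma brace_extension_induced:
  assumes E: "rrb_extension A K E" and "rrb_group K"
  shows "brace_extension (induced_brace A) (induced_brace K) (induced_brace_ext E)"
proof -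
  have "rrb_group (ext_mid E)" using E by (simp add: rrb_extension_def)
  with E \<open>rrb_group K\<close> show ?thesis
    by (auto simp: brace_extension_def rrb_extension_def induced_brace_ext_def kernel_def
        rrb.skew_left_brace_induced rrb_def intro: skew_brace_hom_induced)
qed

section \<open>Equivalence of extensions\<close>

lemma rrb_hom_compose:
  assumes "(\<psi>, \<eta>) \<in> rrb_hom X Y" "(\<psi>', \<eta>') \<in> rrb_hom Y Z"
  shows "(\<psi>' \<circ> \<psi>, \<eta>' \<circ> \<eta>) \<in> rrb_hom X Z"
  using assms by (auto simp: rrb_hom_def hom_def Pi_iff)

lemma rrb_ext_equiv_trans:
  assumes "rrb_ext_equiv A K E F" "rrb_ext_equiv A K F F'"
  shows "rrb_ext_equiv A K E F'"
proof -
  obtain \<psi> \<eta> \<psi>' \<eta>' where 1: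
    "(\<psi>, \<eta>) \<in> rrb_hom (ext_mid E) (ext_mid F)"
     "bij_betw \<psi> (carrier (rrb_H (ext_mid E))) (carrier (rrb_H (ext_mid F)))"
     "bij_betw \<eta> (carrier (rrb_G (ext_mid E))) (carrier (rrb_G (ext_mid F)))"
     "\<forall>k\<in>carrier (rrb_H K). \<psi> (ext_i1 E k) = ext_i1 F k"
     "\<forall>l\<in>carrier (rrb_G K). \<eta> (ext_i2 E l) = ext_i2 F l"
     "\<forall>h\<in>carrier (rrb_H (ext_mid E)). ext_p1 F (\<psi> h) = ext_p1 E h"
     "\<forall>g\<in>carrier (rrb_G (ext_mid E)). ext_p2 F (\<eta> g) = ext_p2 E g"
   and 2:
    "(\<psi>', \<eta>') \<in> rrb_hom (ext_mid F) (ext_mid F')"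
     "bij_betw \<psi>' (carrier (rrb_H (ext_mid F))) (carrier (rrb_H (ext_mid F')))"
     "bij_betw \<eta>' (carrier (rrb_G (ext_mid F))) (carrier (rrb_G (ext_mid F')))"
     "\<forall>k\<in>carrier (rrb_H K). \<psi>' (ext_i1 F k) = ext_i1 F' k"
     "\<forall>l\<in>carrier (rrb_G K). \<eta>' (ext_i2 F l) = ext_i2 F' l"
     "\<forall>h\<in>carrier (rrb_H (ext_mid F)). ext_p1 F' (\<psi>' h) = ext_p1 F h"
     "\<forall>g\<in>carrier (rrb_G (ext_mid F)). ext_p2 F' (\<eta>' g) = ext_p2 F g"
    using assms unfolding rrb_ext_equiv_def by auto
  show ?thesis
    unfolding rrb_ext_equiv_def
    using rrb_hom_compose[OF 1(1) 2(1)] bij_betw_trans[OF 1(2) 2(2)] bij_betw_trans[OF 1(3) 2(3)]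
      1(4-7) 2(4-7) bij_betw_apply[OF 1(2)] bij_betw_apply[OF 1(3)]
    by (intro exI[of _ "\<psi>' \<circ> \<psi>"] exI[of _ "\<eta>' \<circ> \<eta>"]) auto
qed

lemma skew_brace_hom_compose:
  "\<psi> \<in> skew_brace_hom M N \<Longrightarrow> \<psi>' \<in> skew_brace_hom N P \<Longrightarrow> \<psi>' \<circ> \<psi> \<in> skew_brace_hom M P"
  by (auto simp: skew_brace_hom_def hom_def Pi_iff)

lemma brace_ext_equiv_refl: "brace_ext_equiv M I E E"
  unfolding brace_ext_equiv_def
  by (rule exI[of _ id]) (auto simp: skew_brace_hom_def hom_def)

lemma brace_ext_equiv_trans:
  assumes "brace_ext_equiv M I E F" "brace_ext_equiv M I F F'"
  shows "brace_ext_equiv M I E F'"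
proof -
  obtain \<psi> \<psi>' where 1: "\<psi> \<in> skew_brace_hom (bext_mid E) (bext_mid F)"
     "bij_betw \<psi> (carrier (bext_mid E)) (carrier (bext_mid F))"
     "\<forall>y\<in>carrier I. \<psi> (bext_i E y) = bext_i F y"
     "\<forall>x\<in>carrier (bext_mid E). bext_p F (\<psi> x) = bext_p E x"
   and 2: "\<psi>' \<in> skew_brace_hom (bext_mid F) (bext_mid F')"
     "bij_betw \<psi>' (carrier (bext_mid F)) (carrier (bext_mid F'))"
     "\<forall>y\<in>carrier I. \<psi>' (bext_i F y) = bext_i F' y"
     "\<forall>x\<in>carrier (bext_mid F). bext_p F' (\<psi>' x) = bext_p F x"
    using assms unfolding brace_ext_equiv_def by auto
  show ?thesis
    unfolding brace_ext_equiv_def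
    using skew_brace_hom_compose[OF 1(1) 2(1)] bij_betw_trans[OF 1(2) 2(2)] 1(3-4) 2(3-4)
      bij_betw_apply[OF 1(2)]
    by (intro exI[of _ "\<psi>' \<circ> \<psi>"]) auto
qed

text \<open>\<open>Pi_map\<close> and \<open>Lambda\<close> range over all extensions equivalent to
  a given one, and members of a class have to be compared with it in both directions. For
  \<open>rrb_ext_equiv\<close> the backward direction comes instead from the symmetry of cosets of
  cocycles.\<close>

lemma brace_ext_equiv_sym:
  assumes "brace_extension M I E" "brace_ext_equiv M I E F"
  shows "brace_ext_equiv M I F E"
proof -
  obtain \<psi> where \<psi>: "\<psi> \<in> skew_brace_hom (bext_mid E) (bext_mid F)"
     "bij_betw \<psi> (carrier (bext_mid E)) (carrier (bext_mid F))"
     "\<forall>y\<in>carrier I. \<psi> (bext_i E y) = bext_i F y"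
     "\<forall>x\<in>carrier (bext_mid E). bext_p F (\<psi> x) = bext_p E x"
    using assms unfolding brace_ext_equiv_def by auto
  let ?\<psi> = "inv_into (carrier (bext_mid E)) \<psi>"
  have grp: "group (bext_mid E)" "group (circ_group (bext_mid E))"
    using assms(1) by (auto simp: brace_extension_def skew_left_brace_def)
  have i: "bext_i E y \<in> carrier (bext_mid E)" if "y \<in> carrier I" for y
    using assms(1) that by (auto simp: brace_extension_def skew_brace_hom_def hom_def)
  have "?\<psi> \<in> skew_brace_hom (bext_mid F) (bext_mid E)"
    using \<psi>(1,2) group.iso_set_sym[OF grp(1), of \<psi> "bext_mid F"]
      group.iso_set_sym[OF grp(2), of \<psi> "circ_group (bext_mid F)"]
    by (simp add: skew_brace_hom_def iso_def)
  moreover have "?\<psi> (bext_i F y) = bext_i E y" if "y \<in> carrier I" for y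
    using \<psi>(2,3) i[OF that] that by (metis bij_betw_inv_into_left)
  moreover have "bext_p E (?\<psi> x) = bext_p F x" if "x \<in> carrier (bext_mid F)" for x
    using \<psi>(4) that bij_betw_inv_into_right[OF \<psi>(2) that] bij_betw_apply[OF bij_betw_inv_into[OF \<psi>(2)] that]
    by metis
  ultimately show ?thesis
    unfolding brace_ext_equiv_def using bij_betw_inv_into[OF \<psi>(2)] by blast
qed

lemma brace_ext_equiv_induced:
  assumes "rrb_ext_equiv A K E F" "rrb_group (ext_mid E)"
  shows "brace_ext_equiv (induced_brace A) (induced_brace K) (induced_brace_ext E) (induced_brace_ext F)"
proof -
  obtain \<psi> \<eta> where "(\<psi>, \<eta>) \<in> rrb_hom (ext_mid E) (ext_mid F)"
     "bij_betw \<psi> (carrier (rrb_H (ext_mid E))) (carrier (rrb_H (ext_mid F)))"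
     "\<forall>k\<in>carrier (rrb_H K). \<psi> (ext_i1 E k) = ext_i1 F k"
     "\<forall>h\<in>carrier (rrb_H (ext_mid E)). ext_p1 F (\<psi> h) = ext_p1 E h"
    using assms(1) unfolding rrb_ext_equiv_def by (elim exE conjE) (rule that)
  moreover from this(1) have "\<psi> \<in> skew_brace_hom (induced_brace (ext_mid E)) (induced_brace (ext_mid F))"
    using assms(2) by (rule skew_brace_hom_induced)
  ultimately show ?thesis
    unfolding brace_ext_equiv_def induced_brace_ext_def by (intro exI[of _ \<psi>]) simp
qed

text \<open>An equivalence \<psi> carries s to the section \<psi> \<circ> s and is compatible with
  both embeddings of I. The kernel elements that define the two cocycles thus have the same preimage
  in I: the cocycle itself is preserved, not merely its class.\<close>

lemma section_cocycle_equiv: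
  assumes E: "brace_extension M I E" and F: "brace_extension M I F" and eq: "brace_ext_equiv M I E F"
    and M: "skew_left_brace M" and s: "normalized_section M E s"
  obtains t where "normalized_section M F t" "section_cocycle M I F t = section_cocycle M I E s"
proof -
  obtain \<psi> where \<psi>: "\<psi> \<in> skew_brace_hom (bext_mid E) (bext_mid F)"
     "bij_betw \<psi> (carrier (bext_mid E)) (carrier (bext_mid F))"
     "\<forall>y\<in>carrier I. \<psi> (bext_i E y) = bext_i F y"
     "\<forall>x\<in>carrier (bext_mid E). bext_p F (\<psi> x) = bext_p E x"
    using eq unfolding brace_ext_equiv_def by auto
  interpret E: group "bext_mid E" using E by (simp add: brace_extension_def skew_left_brace_def)
  interpret F: group "bext_mid F" using F by (simp add: brace_extension_def skew_left_brace_def)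
  interpret M: group M using M by (simp add: skew_left_brace_def)
  interpret Ec: group "circ_group (bext_mid E)" using E by (simp add: brace_extension_def skew_left_brace_def)
  interpret Mc: group "circ_group M" using M by (simp add: skew_left_brace_def)
  interpret \<psi>: group_hom "bext_mid E" "bext_mid F" \<psi>
    using \<psi>(1) by (auto simp: skew_brace_hom_def group_hom_def group_hom_axioms_def E.group_axioms F.group_axioms)
  have \<psi>c: "\<psi> (circ (bext_mid E) x y) = circ (bext_mid F) (\<psi> x) (\<psi> y)"
    if "x \<in> carrier (bext_mid E)" "y \<in> carrier (bext_mid E)" for x y
    using \<psi>(1) that by (auto simp: skew_brace_hom_def hom_def)
  interpret p: group_hom "bext_mid E" M "bext_p E"
    using E by (auto simp: brace_extension_def skew_brace_hom_def group_hom_def group_hom_axioms_def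
        E.group_axioms M.group_axioms)
  have pc: "bext_p E (circ (bext_mid E) x y) = circ M (bext_p E x) (bext_p E y)"
    if "x \<in> carrier (bext_mid E)" "y \<in> carrier (bext_mid E)" for x y
    using E that by (auto simp: brace_extension_def skew_brace_hom_def hom_def)
  have injE: "inj_on (bext_i E) (carrier I)" and injF: "inj_on (bext_i F) (carrier I)"
    and kerE: "bext_i E ` carrier I = kernel (bext_mid E) M (bext_p E)"
    using E F by (auto simp: brace_extension_def)
  have sE: "s m \<in> carrier (bext_mid E)" "bext_p E (s m) = m" if "m \<in> carrier M" for m
    using s that by (auto simp: normalized_section_def)
  have circE: "circ (bext_mid E) x y \<in> carrier (bext_mid E)"
    if "x \<in> carrier (bext_mid E)" "y \<in> carrier (bext_mid E)" for x y
    using Ec.m_closed that by simp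
  have circM: "circ M x y \<in> carrier M" if "x \<in> carrier M" "y \<in> carrier M" for x y
    using Mc.m_closed that by simp
  have inv_i: "inv_into (carrier I) (bext_i F) (\<psi> x) = inv_into (carrier I) (bext_i E) x"
    if "x \<in> carrier (bext_mid E)" "bext_p E x = \<one>\<^bsub>M\<^esub>" for x
  proof -
    \<comment> \<open>\<open>inv_into\<close> is meaningful only on the image of I. By exactness,
      this is the kernel of the projection.\<close>
    have "x \<in> bext_i E ` carrier I"
      unfolding kerE using that by (simp add: kernel_def)
    then obtain y where y: "y \<in> carrier I" "x = bext_i E y"
      by blast
    then show ?thesis
      using \<psi>(3) by (simp add: inv_into_f_f[OF injE] inv_into_f_f[OF injF])
  qed
  have add: "inv_into (carrier I) (bext_i F)
        (inv\<^bsub>bext_mid F\<^esub> (\<psi> (s (x \<otimes>\<^bsub>M\<^esub> y))) \<otimes>\<^bsub>bext_mid F\<^esub> (\<psi> (s x) \<otimes>\<^bsub>bext_mid F\<^esub> \<psi> (s y))) =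
      inv_into (carrier I) (bext_i E)
        (inv\<^bsub>bext_mid E\<^esub> (s (x \<otimes>\<^bsub>M\<^esub> y)) \<otimes>\<^bsub>bext_mid E\<^esub> (s x \<otimes>\<^bsub>bext_mid E\<^esub> s y))"
    if "x \<in> carrier M" "y \<in> carrier M" for x y
    using inv_i[of "inv\<^bsub>bext_mid E\<^esub> (s (x \<otimes>\<^bsub>M\<^esub> y)) \<otimes>\<^bsub>bext_mid E\<^esub> (s x \<otimes>\<^bsub>bext_mid E\<^esub> s y)"]
    by (simp add: that sE)
  have mul: "inv_into (carrier I) (bext_i F)
        (inv\<^bsub>bext_mid F\<^esub> (\<psi> (s (circ M x y))) \<otimes>\<^bsub>bext_mid F\<^esub> circ (bext_mid F) (\<psi> (s x)) (\<psi> (s y))) =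
      inv_into (carrier I) (bext_i E)
        (inv\<^bsub>bext_mid E\<^esub> (s (circ M x y)) \<otimes>\<^bsub>bext_mid E\<^esub> circ (bext_mid E) (s x) (s y))"
    if "x \<in> carrier M" "y \<in> carrier M" for x y
    using inv_i[of "inv\<^bsub>bext_mid E\<^esub> (s (circ M x y)) \<otimes>\<^bsub>bext_mid E\<^esub> circ (bext_mid E) (s x) (s y)"]
    by (simp add: that sE circE circM pc \<psi>c)
  show thesis
  proof (rule that)
    show "normalized_section M F (\<psi> \<circ> s)"
      using s \<psi>(4) by (auto simp: normalized_section_def Pi_iff)
    show "section_cocycle M I F (\<psi> \<circ> s) = section_cocycle M I E s"
      by (auto simp: section_cocycle_def fun_eq_iff add mul)
  qed
qed

section \<open>Modules and the group of cocycles\<close>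

locale rrb_mod = A: rrb A for A :: "('a, 'b) rrb" +
  fixes K :: "('k, 'l) rrb" and \<nu> :: "'b \<Rightarrow> 'k \<Rightarrow> 'k" and \<mu> :: "'a \<Rightarrow> 'k \<Rightarrow> 'k"
    and \<sigma> :: "'b \<Rightarrow> 'l \<Rightarrow> 'l" and f :: "'l \<Rightarrow> 'a \<Rightarrow> 'k"
  assumes rrb_module: "rrb_module A K \<nu> \<mu> \<sigma> f"

sublocale rrb_mod \<subseteq> N: comm_group "rrb_H K" using rrb_module by (simp add: rrb_module_def)
sublocale rrb_mod \<subseteq> L: comm_group "rrb_G K" using rrb_module by (simp add: rrb_module_def)

context rrb_mod
begin

abbreviation cA where "cA \<equiv> carrier (rrb_H A)"
abbreviation cB where "cB \<equiv> carrier (rrb_G A)"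
abbreviation cK where "cK \<equiv> carrier (rrb_H K)"
abbreviation cL where "cL \<equiv> carrier (rrb_G K)"
abbreviation multA (infixl "\<cdot>" 70) where "x \<cdot> y \<equiv> x \<otimes>\<^bsub>rrb_H A\<^esub> y"
abbreviation multB (infixl "\<diamondop>" 70) where "x \<diamondop> y \<equiv> x \<otimes>\<^bsub>rrb_G A\<^esub> y"
abbreviation multK (infixl "\<star>" 70) where "x \<star> y \<equiv> x \<otimes>\<^bsub>rrb_H K\<^esub> y"
abbreviation multL (infixl "\<bullet>" 70) where "x \<bullet> y \<equiv> x \<otimes>\<^bsub>rrb_G K\<^esub> y"
abbreviation oneA ("1\<^sub>A") where "1\<^sub>A \<equiv> \<one>\<^bsub>rrb_H A\<^esub>"
abbreviation oneB ("1\<^sub>B") where "1\<^sub>B \<equiv> \<one>\<^bsub>rrb_G A\<^esub>"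
abbreviation oneK ("1\<^sub>K") where "1\<^sub>K \<equiv> \<one>\<^bsub>rrb_H K\<^esub>"
abbreviation oneL ("1\<^sub>L") where "1\<^sub>L \<equiv> \<one>\<^bsub>rrb_G K\<^esub>"
abbreviation invA where "invA x \<equiv> inv\<^bsub>rrb_H A\<^esub> x"
abbreviation invB where "invB x \<equiv> inv\<^bsub>rrb_G A\<^esub> x"
abbreviation invK where "invK x \<equiv> inv\<^bsub>rrb_H K\<^esub> x"
abbreviation invL where "invL x \<equiv> inv\<^bsub>rrb_G K\<^esub> x"
abbreviation \<beta> where "\<beta> \<equiv> rrb_act A"
abbreviation T where "T \<equiv> rrb_op A"
abbreviation S where "S \<equiv> rrb_op K"

lemma rrb_K: "rrb_group K"
  using rrb_module by (simp add: rrb_module_def)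

lemma trivial_K: "l \<in> cL \<Longrightarrow> k \<in> cK \<Longrightarrow> rrb_act K l k = k"
  using rrb_module by (simp add: rrb_module_def rrb_trivial_def)

lemma \<nu>_hom: "\<nu> \<in> hom (rrb_G A) (AutoGroup (rrb_H K))"
  and \<mu>_antihom: "\<mu> \<in> antihom (rrb_H A) (AutoGroup (rrb_H K))"
  and \<sigma>_antihom: "\<sigma> \<in> antihom (rrb_G A) (AutoGroup (rrb_G K))"
  using rrb_module by (simp_all add: rrb_module_def)

text \<open>The simp rules for a module aim at one normal form: products in the index of \<nu>,
  \<mu>, \<sigma> become iterated applications, in reversed order for the two antihomomorphisms;
  each map is distributed over products and inverses; \<open>\<nu>_\<mu>\<close> moves \<nu> inside
  \<mu>; and \<open>f_act\<close> frees the second argument of f from \<beta>.\<close>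

lemmas \<nu>_simps [simp] = hom_AutoGroup(2-4)[OF A.G.group_axioms N.group_axioms \<nu>_hom]
lemmas \<mu>_simps [simp] = antihom_AutoGroup(2-3)[OF A.H.group_axioms N.group_axioms \<mu>_antihom]
lemmas \<sigma>_simps [simp] = antihom_AutoGroup(2-3)[OF A.G.group_axioms L.group_axioms \<sigma>_antihom]
lemmas \<nu>_auto = hom_AutoGroup(1)[OF A.G.group_axioms N.group_axioms \<nu>_hom]
lemmas \<mu>_auto = antihom_AutoGroup(1)[OF A.H.group_axioms N.group_axioms \<mu>_antihom]
lemmas \<sigma>_auto = antihom_AutoGroup(1)[OF A.G.group_axioms L.group_axioms \<sigma>_antihom]

lemmas \<nu>_hom_simps [simp] =
  N.auto_closed[OF \<nu>_auto] N.auto_mult[OF \<nu>_auto] N.auto_one[OF \<nu>_auto] N.auto_inv[OF \<nu>_auto]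
lemmas \<mu>_hom_simps [simp] =
  N.auto_closed[OF \<mu>_auto] N.auto_mult[OF \<mu>_auto] N.auto_one[OF \<mu>_auto] N.auto_inv[OF \<mu>_auto]
lemmas \<sigma>_hom_simps [simp] =
  L.auto_closed[OF \<sigma>_auto] L.auto_mult[OF \<sigma>_auto] L.auto_one[OF \<sigma>_auto] L.auto_inv[OF \<sigma>_auto]

lemma \<nu>_inv_\<nu> [simp]:
  assumes "b \<in> cB" "k \<in> cK"
  shows "\<nu> (invB b) (\<nu> b k) = k" and "\<nu> b (\<nu> (invB b) k) = k"
  using assms by (simp_all flip: \<nu>_simps(1))

lemma S_group_hom: "group_hom (rrb_H K) (rrb_G K) S"
proof -
  interpret K: rrb K by unfold_locales (rule rrb_K)
  \<comment> \<open>As the action of K is trivial, the Rota-Baxter identity degenerates to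
    multiplicativity.\<close>
  have "S (x \<star> y) = S x \<bullet> S y" if "x \<in> cK" "y \<in> cK" for x y
    using K.op_circ[OF that] that by (simp add: trivial_K)
  then show ?thesis
    by (simp add: group_hom_def group_hom_axioms_def hom_def N.group_axioms L.group_axioms)
qed

lemmas S_simps [simp] =
  group_hom.hom_closed[OF S_group_hom] group_hom.hom_mult[OF S_group_hom]
  group_hom.hom_one[OF S_group_hom] group_hom.hom_inv[OF S_group_hom]

lemma f_group_hom: "a \<in> cA \<Longrightarrow> group_hom (rrb_G K) (rrb_H K) (\<lambda>l. f l a)"
  using rrb_module
  by (auto simp: rrb_module_def group_hom_def group_hom_axioms_def hom_def N.group_axioms L.group_axioms)

lemmas f_simps [simp] =
  group_hom.hom_closed[OF f_group_hom] group_hom.hom_mult[OF f_group_hom]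
  group_hom.hom_one[OF f_group_hom] group_hom.hom_inv[OF f_group_hom]

lemma f_mult [simp]:
  "l \<in> cL \<Longrightarrow> a \<in> cA \<Longrightarrow> a' \<in> cA \<Longrightarrow> f l (a \<cdot> a') = \<mu> a' (f l a) \<star> f l a'"
  using rrb_module unfolding rrb_module_def by blast

lemma f_one [simp]: "l \<in> cL \<Longrightarrow> f l 1\<^sub>A = 1\<^sub>K"
  using f_mult[of l "1\<^sub>A" "1\<^sub>A"] by simp

lemma \<nu>_\<mu> [simp]: "a \<in> cA \<Longrightarrow> b \<in> cB \<Longrightarrow> k \<in> cK \<Longrightarrow> \<nu> b (\<mu> a k) = \<mu> (\<beta> b a) (\<nu> b k)"
  using rrb_module unfolding rrb_module_def by blast

lemma f_act [simp]: "a \<in> cA \<Longrightarrow> b \<in> cB \<Longrightarrow> l \<in> cL \<Longrightarrow> f l (\<beta> b a) = \<nu> b (f (\<sigma> b l) a)"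
  using rrb_module unfolding rrb_module_def by metis

text \<open>The module condition that ties \<sigma> to \<mu>, \<nu> and f through S, in the normal
  form of the simp rules. It is applied from right to left: \<sigma> (T a) on a value of S becomes a
  product of values of S.\<close>

lemma \<sigma>_T_S:
  assumes "a \<in> cA" "k \<in> cK"
  shows "S (\<mu> (\<beta> (invB (T a)) a) (\<nu> (invB (T a)) k)) \<bullet> S (\<nu> (invB (T a)) (f (S k) a)) = \<sigma> (T a) (S k)"
proof -
  have "S ((inv\<^bsub>AutoGroup (rrb_H K)\<^esub> (\<nu> (T a))) (\<mu> a k) \<star> (inv\<^bsub>AutoGroup (rrb_H K)\<^esub> (\<nu> (T a))) (f (S k) a))
    = \<sigma> (T a) (S k)"
    using rrb_module assms unfolding rrb_module_def by blast
  then show ?thesis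
    using assms by simp
qed

section \<open>The groups of cocycles and coboundaries of a relative Rota-Baxter group\<close>

abbreviation "C1 \<equiv> C1_RRB A K"
abbreviation "C2 \<equiv> C2_RRB A K"
abbreviation "Z2 \<equiv> Z2_RRB A K \<nu> \<mu> \<sigma> f"
abbreviation "B2 \<equiv> B2_RRB A K \<nu> \<mu> \<sigma> f"

lemma comm_group_C1: "comm_group C1"
  by (simp add: C1_RRB_def comm_group_DirProd comm_group_cochains1 N.comm_group_axioms L.comm_group_axioms)

lemma comm_group_C2: "comm_group C2"
  by (simp add: C2_RRB_def comm_group_DirProd comm_group_cochains1 comm_group_cochains2
      N.comm_group_axioms L.comm_group_axioms)

lemma C1_iff:
  "(\<theta>1, \<theta>2) \<in> carrier C1 \<longleftrightarrow>
     \<theta>1 \<in> cA \<rightarrow>\<^sub>E cK \<and> \<theta>1 1\<^sub>A = 1\<^sub>K \<and> \<theta>2 \<in> cB \<rightarrow>\<^sub>E cL \<and> \<theta>2 1\<^sub>B = 1\<^sub>L"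
  by (auto simp: C1_RRB_def cochains1_iff)

lemma C2_iff:
  "(\<tau>1, \<tau>2, \<rho>, \<chi>) \<in> carrier C2 \<longleftrightarrow>
     (\<tau>1 \<in> cA \<times> cA \<rightarrow>\<^sub>E cK \<and> (\<forall>a\<in>cA. \<tau>1 (1\<^sub>A, a) = 1\<^sub>K) \<and> (\<forall>a\<in>cA. \<tau>1 (a, 1\<^sub>A) = 1\<^sub>K)) \<and>
     (\<tau>2 \<in> cB \<times> cB \<rightarrow>\<^sub>E cL \<and> (\<forall>b\<in>cB. \<tau>2 (1\<^sub>B, b) = 1\<^sub>L) \<and> (\<forall>b\<in>cB. \<tau>2 (b, 1\<^sub>B) = 1\<^sub>L)) \<and>
     (\<rho> \<in> cA \<times> cB \<rightarrow>\<^sub>E cK \<and> (\<forall>b\<in>cB. \<rho> (1\<^sub>A, b) = 1\<^sub>K) \<and> (\<forall>a\<in>cA. \<rho> (a, 1\<^sub>B) = 1\<^sub>K)) \<and>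
     (\<chi> \<in> cA \<rightarrow>\<^sub>E cL \<and> \<chi> 1\<^sub>A = 1\<^sub>L)"
  by (simp add: C2_RRB_def cochains1_iff cochains2_iff)

lemma mult_C1 [simp]:
  "(\<theta>1, \<theta>2) \<otimes>\<^bsub>C1\<^esub> (\<theta>1', \<theta>2') = (\<lambda>a\<in>cA. \<theta>1 a \<star> \<theta>1' a, \<lambda>b\<in>cB. \<theta>2 b \<bullet> \<theta>2' b)"
  by (simp add: C1_RRB_def)

lemma mult_C2 [simp]:
  "(\<tau>1, \<tau>2, \<rho>, \<chi>) \<otimes>\<^bsub>C2\<^esub> (\<tau>1', \<tau>2', \<rho>', \<chi>') =
     (\<lambda>x\<in>cA \<times> cA. \<tau>1 x \<star> \<tau>1' x, \<lambda>x\<in>cB \<times> cB. \<tau>2 x \<bullet> \<tau>2' x,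
      \<lambda>x\<in>cA \<times> cB. \<rho> x \<star> \<rho>' x, \<lambda>a\<in>cA. \<chi> a \<bullet> \<chi>' a)"
  by (simp add: C2_RRB_def)

lemma mult_Z2 [simp]: "mult Z2 = mult C2"
  by (simp add: Z2_RRB_def)

text \<open>In this form no value of a cochain is inverted, and \<nu> at T of a circle product is
  split into two applications. The conditions can thus be compared with products by AC
  rewriting.\<close>

lemma Z2_iff:
  "(\<tau>1, \<tau>2, \<rho>, \<chi>) \<in> carrier Z2 \<longleftrightarrow> (\<tau>1, \<tau>2, \<rho>, \<chi>) \<in> carrier C2 \<and>
     (\<forall>x\<in>cA. \<forall>y\<in>cA. \<forall>z\<in>cA. \<tau>1 (y, z) \<star> \<tau>1 (x, y \<cdot> z) = \<tau>1 (x \<cdot> y, z) \<star> \<mu> z (\<tau>1 (x, y))) \<and>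
     (\<forall>x\<in>cB. \<forall>y\<in>cB. \<forall>z\<in>cB. \<tau>2 (y, z) \<bullet> \<tau>2 (x, y \<diamondop> z) = \<tau>2 (x \<diamondop> y, z) \<bullet> \<sigma> z (\<tau>2 (x, y))) \<and>
     (\<forall>x\<in>cA. \<forall>b\<in>cB. \<forall>c\<in>cB.
        \<rho> (x, b \<diamondop> c) \<star> \<nu> b (\<nu> c (f (\<tau>2 (b, c)) x)) = \<rho> (\<beta> c x, b) \<star> \<nu> b (\<rho> (x, c))) \<and>
     (\<forall>x\<in>cA. \<forall>y\<in>cA. \<forall>b\<in>cB.
        \<rho> (x \<cdot> y, b) \<star> \<nu> b (\<tau>1 (x, y)) =
        \<mu> (\<beta> b y) (\<rho> (x, b)) \<star> \<rho> (y, b) \<star> \<tau>1 (\<beta> b x, \<beta> b y)) \<and>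
     (\<forall>x\<in>cA. \<forall>y\<in>cA.
        S (\<nu> (invB (T y)) (\<nu> (invB (T x))
          (\<rho> (y, T x) \<star> \<tau>1 (x, \<beta> (T x) y) \<star> \<nu> (T x) (f (\<chi> x) y)))) \<bullet> \<chi> (x \<cdot> \<beta> (T x) y)
        = \<tau>2 (T x, T y) \<bullet> (\<chi> y \<bullet> \<sigma> (T y) (\<chi> x)))"
  (is "?l \<longleftrightarrow> ?C \<and> ?c1 \<and> ?c2 \<and> ?c3 \<and> ?c4 \<and> ?c5")
proof (cases ?C)
  case True
  then have [simp]: "x \<in> cA \<Longrightarrow> y \<in> cA \<Longrightarrow> \<tau>1 (x, y) \<in> cK" "x \<in> cA \<Longrightarrow> b \<in> cB \<Longrightarrow> \<rho> (x, b) \<in> cK"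
    "x \<in> cA \<Longrightarrow> \<chi> x \<in> cL" "b \<in> cB \<Longrightarrow> c \<in> cB \<Longrightarrow> \<tau>2 (b, c) \<in> cL" for x y b c
    by (auto simp: C2_iff)
  define d where "d = d2_RRB A K \<nu> \<mu> \<sigma> f (\<tau>1, \<tau>2, \<rho>, \<chi>)"
  have "?l \<longleftrightarrow> d = \<one>\<^bsub>C3_RRB A K\<^esub>"
    using True by (simp add: Z2_RRB_def kernel_def d_def)
  also have "\<dots> \<longleftrightarrow> fst d = (\<lambda>_\<in>cA \<times> cA \<times> cA. 1\<^sub>K) \<and> fst (snd d) = (\<lambda>_\<in>cB \<times> cB \<times> cB. 1\<^sub>L) \<and>
      fst (snd (snd d)) = (\<lambda>_\<in>cA \<times> cB \<times> cB. 1\<^sub>K) \<and> fst (snd (snd (snd d))) = (\<lambda>_\<in>cA \<times> cA \<times> cB. 1\<^sub>K) \<and>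
      snd (snd (snd (snd d))) = (\<lambda>_\<in>cA \<times> cA. 1\<^sub>L)"
    by (cases d) (simp add: C3_RRB_def)
  also have "fst d = (\<lambda>_\<in>cA \<times> cA \<times> cA. 1\<^sub>K) \<longleftrightarrow> ?c1"
    by (simp add: d_def d2_RRB_def d2_def restrict_eq_restrict_iff, intro ball_cong refl)
      (auto simp: N.quot_simps N.m_ac)
  also have "fst (snd d) = (\<lambda>_\<in>cB \<times> cB \<times> cB. 1\<^sub>L) \<longleftrightarrow> ?c2"
    by (simp add: d_def d2_RRB_def d2_def restrict_eq_restrict_iff, intro ball_cong refl)
      (auto simp: L.quot_simps L.m_ac)
  also have "fst (snd (snd d)) = (\<lambda>_\<in>cA \<times> cB \<times> cB. 1\<^sub>K) \<longleftrightarrow> ?c3"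
    by (simp add: d_def d2_RRB_def restrict_eq_restrict_iff, intro ball_cong refl)
      (auto simp: N.quot_simps N.m_ac)
  also have "fst (snd (snd (snd d))) = (\<lambda>_\<in>cA \<times> cA \<times> cB. 1\<^sub>K) \<longleftrightarrow> ?c4"
    by (simp add: d_def d2_RRB_def restrict_eq_restrict_iff, intro ball_cong refl)
      (auto simp: N.quot_simps N.m_ac)
  also have "snd (snd (snd (snd d))) = (\<lambda>_\<in>cA \<times> cA. 1\<^sub>L) \<longleftrightarrow> ?c5"
    by (simp add: d_def d2_RRB_def delta1_def restrict_eq_restrict_iff A.G.inv_mult_group, intro ball_cong refl)
      (auto simp: L.quot_simps L.m_ac)
  finally show ?thesis
    using True by simp
next
  case False
  then show ?thesis
    by (simp add: Z2_RRB_def kernel_def)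
qed


lemma comm_group_Z2: "comm_group Z2"
  and subgroup_Z2: "subgroup (carrier Z2) C2"
proof -
  interpret C2: comm_group C2 by (rule comm_group_C2)
  \<comment> \<open>P is \<open>C3_RRB\<close> without normalization. Its unit is the same and so is
    the kernel, which saves checking that \<open>d2_RRB\<close> produces normalized
    cochains.\<close>
  define P where "P = product_group (cA \<times> cA \<times> cA) (\<lambda>_. rrb_H K) \<times>\<times>
    product_group (cB \<times> cB \<times> cB) (\<lambda>_. rrb_G K) \<times>\<times>
    product_group (cA \<times> cB \<times> cB) (\<lambda>_. rrb_H K) \<times>\<times>
    product_group (cA \<times> cA \<times> cB) (\<lambda>_. rrb_H K) \<times>\<times> product_group (cA \<times> cA) (\<lambda>_. rrb_G K)"
  let ?d = "d2_RRB A K \<nu> \<mu> \<sigma> f"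
  have "group P"
    unfolding P_def by (intro DirProd_group product_group N.group_axioms L.group_axioms)
  moreover have "?d \<in> hom C2 P"
  proof (rule homI)
    fix z assume "z \<in> carrier C2"
    moreover obtain \<tau>1 \<tau>2 \<rho> \<chi> where z: "z = (\<tau>1, \<tau>2, \<rho>, \<chi>)" by (cases z)
    ultimately have [simp]: "x \<in> cA \<Longrightarrow> y \<in> cA \<Longrightarrow> \<tau>1 (x, y) \<in> cK" "x \<in> cA \<Longrightarrow> b \<in> cB \<Longrightarrow> \<rho> (x, b) \<in> cK"
      "x \<in> cA \<Longrightarrow> \<chi> x \<in> cL" "b \<in> cB \<Longrightarrow> c \<in> cB \<Longrightarrow> \<tau>2 (b, c) \<in> cL" for x y b c
      by (auto simp: C2_iff)
    show "?d z \<in> carrier P"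
      by (auto simp: z P_def d2_RRB_def d2_def delta1_def A.G.inv_mult_group)
    fix z' assume "z' \<in> carrier C2"
    moreover obtain \<tau>1' \<tau>2' \<rho>' \<chi>' where z': "z' = (\<tau>1', \<tau>2', \<rho>', \<chi>')" by (cases z')
    ultimately have [simp]: "x \<in> cA \<Longrightarrow> y \<in> cA \<Longrightarrow> \<tau>1' (x, y) \<in> cK" "x \<in> cA \<Longrightarrow> b \<in> cB \<Longrightarrow> \<rho>' (x, b) \<in> cK"
      "x \<in> cA \<Longrightarrow> \<chi>' x \<in> cL" "b \<in> cB \<Longrightarrow> c \<in> cB \<Longrightarrow> \<tau>2' (b, c) \<in> cL" for x y b c
      by (auto simp: C2_iff)
    show "?d (z \<otimes>\<^bsub>C2\<^esub> z') = ?d z \<otimes>\<^bsub>P\<^esub> ?d z'"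
      by (simp add: z z' P_def d2_RRB_def d2_def delta1_def restrict_eq_restrict_iff A.G.inv_mult_group
          N.inv_mult L.inv_mult, intro conjI ballI) (simp_all add: N.m_ac L.m_ac)
  qed
  ultimately have "group_hom C2 P ?d"
    by (simp add: group_hom_def group_hom_axioms_def C2.group_axioms)
  moreover have "carrier Z2 = kernel C2 P ?d"
    by (simp add: Z2_RRB_def kernel_def P_def C3_RRB_def)
  ultimately show sub: "subgroup (carrier Z2) C2"
    using group_hom.subgroup_kernel by metis
  show "comm_group Z2"
    using C2.comm_group_subgroup[OF sub] by (simp add: Z2_RRB_def)
qed

text \<open>This is d2 d1 = 1. The condition \<open>\<sigma>_T_S\<close> enters only in the last
  component, where \<sigma> meets the value of S in \<lambda>2.\<close>

lemma d1_RRB_closed: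
  assumes "(\<theta>1, \<theta>2) \<in> carrier C1"
  shows "d1_RRB A K \<nu> \<mu> \<sigma> f (\<theta>1, \<theta>2) \<in> carrier Z2"
proof -
  have [simp]: "x \<in> cA \<Longrightarrow> \<theta>1 x \<in> cK" "b \<in> cB \<Longrightarrow> \<theta>2 b \<in> cL" "\<theta>1 1\<^sub>A = 1\<^sub>K" "\<theta>2 1\<^sub>B = 1\<^sub>L" for x b
    using assms by (auto simp: C1_iff)
  have "d1_RRB A K \<nu> \<mu> \<sigma> f (\<theta>1, \<theta>2) \<in> carrier C2"
    by (auto simp: d1_RRB_def d1_def C2_iff)
  then show ?thesis
    unfolding d1_RRB_def split Z2_iff
  proof (intro conjI ballI, goal_cases)
    case (2 x y z)
    then show ?case
      \<comment> \<open>Two passes are needed: the first moves the actions inside inverses, the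
        second turns inverses into \<open>quot\<close>, through which the actions have no rewrite
        rules.\<close>
      apply (simp add: d1_def A.H.m_assoc)
      apply (simp add: N.quot_simps N.m_ac)
      done
  next
    case (3 x y z)
    then show ?case
      apply (simp add: d1_def A.G.m_assoc)
      apply (simp add: L.quot_simps L.m_ac)
      done
  next
    case (4 x b c)
    then show ?case
      apply (simp add: d1_def)
      apply (simp add: N.quot_simps N.m_ac)
      done
  next
    case (5 x y b)
    then show ?case
      apply (simp add: d1_def)
      apply (simp add: N.quot_simps N.m_ac)
      done
  next
    case (6 x y)
    then show ?case
      apply (simp add: d1_def A.G.inv_mult_group flip: \<sigma>_T_S)
      apply (simp add: L.quot_simps L.m_ac)
      done
  qed
qed

lemma d1_RRB_hom: "d1_RRB A K \<nu> \<mu> \<sigma> f \<in> hom C1 Z2"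
proof (rule homI)
  fix t assume "t \<in> carrier C1"
  then show "d1_RRB A K \<nu> \<mu> \<sigma> f t \<in> carrier Z2"
    using d1_RRB_closed by (cases t) blast
  moreover obtain \<theta>1 \<theta>2 where t: "t = (\<theta>1, \<theta>2)" by (cases t)
  ultimately have [simp]: "x \<in> cA \<Longrightarrow> \<theta>1 x \<in> cK" "b \<in> cB \<Longrightarrow> \<theta>2 b \<in> cL" for x b
    using \<open>t \<in> carrier C1\<close> by (auto simp: C1_iff)
  fix t' assume "t' \<in> carrier C1"
  moreover obtain \<theta>1' \<theta>2' where t': "t' = (\<theta>1', \<theta>2')" by (cases t')
  ultimately have [simp]: "x \<in> cA \<Longrightarrow> \<theta>1' x \<in> cK" "b \<in> cB \<Longrightarrow> \<theta>2' b \<in> cL" for x b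
    by (auto simp: C1_iff)
  show "d1_RRB A K \<nu> \<mu> \<sigma> f (t \<otimes>\<^bsub>C1\<^esub> t') = d1_RRB A K \<nu> \<mu> \<sigma> f t \<otimes>\<^bsub>Z2\<^esub> d1_RRB A K \<nu> \<mu> \<sigma> f t'"
    by (auto simp: t t' d1_RRB_def d1_def restrict_eq_restrict_iff N.inv_mult L.inv_mult N.m_ac L.m_ac)
qed

lemma B2_normal: "B2 \<lhd> Z2"
proof -
  interpret Z2: comm_group Z2 by (rule comm_group_Z2)
  interpret C1: comm_group C1 by (rule comm_group_C1)
  have "group_hom C1 Z2 (d1_RRB A K \<nu> \<mu> \<sigma> f)"
    by (simp add: group_hom_def group_hom_axioms_def C1.group_axioms Z2.group_axioms d1_RRB_hom)
  then show ?thesis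
    unfolding B2_RRB_def by (intro Z2.subgroup_imp_normal group_hom.img_is_subgroup)
qed

end

section \<open>The extension defined by a cocycle\<close>

locale rrb_cocycle = rrb_mod A K \<nu> \<mu> \<sigma> f
  for A :: "('a, 'b) rrb" and K :: "('k, 'l) rrb" and \<nu> \<mu> \<sigma> f +
  fixes \<tau>1 \<tau>2 \<rho> \<chi>
  assumes cocycle: "(\<tau>1, \<tau>2, \<rho>, \<chi>) \<in> carrier (Z2_RRB A K \<nu> \<mu> \<sigma> f)"
begin

abbreviation E where "E \<equiv> cocycle_ext A K \<nu> \<mu> \<sigma> f (\<tau>1, \<tau>2, \<rho>, \<chi>)"
abbreviation X where "X \<equiv> ext_mid E"

lemma closed [simp]:
  "x \<in> cA \<Longrightarrow> y \<in> cA \<Longrightarrow> \<tau>1 (x, y) \<in> cK" "b \<in> cB \<Longrightarrow> c \<in> cB \<Longrightarrow> \<tau>2 (b, c) \<in> cL"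
  "x \<in> cA \<Longrightarrow> b \<in> cB \<Longrightarrow> \<rho> (x, b) \<in> cK" "x \<in> cA \<Longrightarrow> \<chi> x \<in> cL"
  using cocycle by (auto simp: Z2_iff C2_iff)

lemma normalized [simp]:
  "x \<in> cA \<Longrightarrow> \<tau>1 (1\<^sub>A, x) = 1\<^sub>K" "x \<in> cA \<Longrightarrow> \<tau>1 (x, 1\<^sub>A) = 1\<^sub>K"
  "b \<in> cB \<Longrightarrow> \<tau>2 (1\<^sub>B, b) = 1\<^sub>L" "b \<in> cB \<Longrightarrow> \<tau>2 (b, 1\<^sub>B) = 1\<^sub>L"
  "b \<in> cB \<Longrightarrow> \<rho> (1\<^sub>A, b) = 1\<^sub>K" "x \<in> cA \<Longrightarrow> \<rho> (x, 1\<^sub>B) = 1\<^sub>K" "\<chi> 1\<^sub>A = 1\<^sub>L"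
  using cocycle by (auto simp: Z2_iff C2_iff)

lemma cocycle_conditions:
  "x \<in> cA \<Longrightarrow> y \<in> cA \<Longrightarrow> z \<in> cA \<Longrightarrow> \<tau>1 (y, z) \<star> \<tau>1 (x, y \<cdot> z) = \<tau>1 (x \<cdot> y, z) \<star> \<mu> z (\<tau>1 (x, y))"
  "b \<in> cB \<Longrightarrow> c \<in> cB \<Longrightarrow> d \<in> cB \<Longrightarrow> \<tau>2 (c, d) \<bullet> \<tau>2 (b, c \<diamondop> d) = \<tau>2 (b \<diamondop> c, d) \<bullet> \<sigma> d (\<tau>2 (b, c))"
  "x \<in> cA \<Longrightarrow> b \<in> cB \<Longrightarrow> c \<in> cB \<Longrightarrow>
     \<rho> (x, b \<diamondop> c) \<star> \<nu> b (\<nu> c (f (\<tau>2 (b, c)) x)) = \<rho> (\<beta> c x, b) \<star> \<nu> b (\<rho> (x, c))"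
  "x \<in> cA \<Longrightarrow> y \<in> cA \<Longrightarrow> b \<in> cB \<Longrightarrow>
     \<rho> (x \<cdot> y, b) \<star> \<nu> b (\<tau>1 (x, y)) = \<mu> (\<beta> b y) (\<rho> (x, b)) \<star> \<rho> (y, b) \<star> \<tau>1 (\<beta> b x, \<beta> b y)"
  "x \<in> cA \<Longrightarrow> y \<in> cA \<Longrightarrow>
     S (\<nu> (invB (T y)) (\<nu> (invB (T x))
       (\<rho> (y, T x) \<star> \<tau>1 (x, \<beta> (T x) y) \<star> \<nu> (T x) (f (\<chi> x) y)))) \<bullet> \<chi> (x \<cdot> \<beta> (T x) y)
     = \<tau>2 (T x, T y) \<bullet> (\<chi> y \<bullet> \<sigma> (T y) (\<chi> x))"
  using cocycle unfolding Z2_iff by blast+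

lemma X_simps [simp]:
  "carrier (rrb_H X) = cA \<times> cK" "\<one>\<^bsub>rrb_H X\<^esub> = (1\<^sub>A, 1\<^sub>K)"
  "(x, k) \<otimes>\<^bsub>rrb_H X\<^esub> (x', k') = (x \<cdot> x', \<mu> x' k \<star> k' \<star> \<tau>1 (x, x'))"
  "carrier (rrb_G X) = cB \<times> cL" "\<one>\<^bsub>rrb_G X\<^esub> = (1\<^sub>B, 1\<^sub>L)"
  "(b, l) \<otimes>\<^bsub>rrb_G X\<^esub> (b', l') = (b \<diamondop> b', \<sigma> b' l \<bullet> l' \<bullet> \<tau>2 (b, b'))"
  "x \<in> cA \<Longrightarrow> k \<in> cK \<Longrightarrow> rrb_act X (b, l) (x, k) = (\<beta> b x, \<rho> (x, b) \<star> \<nu> b (f l x \<star> k))"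
  "x \<in> cA \<Longrightarrow> rrb_op X (x, k) = (T x, \<chi> x \<bullet> S (\<nu> (invB (T x)) k))"
  "ext_i1 E = (\<lambda>k. (1\<^sub>A, k))" "ext_i2 E = (\<lambda>l. (1\<^sub>B, l))" "ext_p1 E = fst" "ext_p2 E = fst"
  by (simp_all add: cocycle_ext_def)

lemma group_H: "group (rrb_H X)"
  unfolding cocycle_ext_def using cocycle_conditions(1)
  by (simp, intro group_cocycle_extension A.H.group_axioms N.comm_group_axioms \<mu>_antihom) auto

lemma group_G: "group (rrb_G X)"
  unfolding cocycle_ext_def using cocycle_conditions(2)
  by (simp, intro group_cocycle_extension A.G.group_axioms L.comm_group_axioms \<sigma>_antihom) auto

text \<open>The conditions of a cocycle correspond to axioms: the first two give associativity of
  the groups, the fourth says that each (b, l) respects products, the third that products of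
  \<open>rrb_G X\<close> act by composition, and the fifth is the Rota-Baxter identity.\<close>

lemma act_X_hom: "rrb_act X \<in> hom (rrb_G X) (AutoGroup (rrb_H X))"
proof (rule hom_AutoGroupI[OF group_G group_H])
  fix g x y assume "g \<in> carrier (rrb_G X)" "x \<in> carrier (rrb_H X)" "y \<in> carrier (rrb_H X)"
  then obtain b l a k a' k' where g: "g = (b, l)" "x = (a, k)" "y = (a', k')"
    "b \<in> cB" "l \<in> cL" "a \<in> cA" "k \<in> cK" "a' \<in> cA" "k' \<in> cK"
    by auto
  show "rrb_act X g (x \<otimes>\<^bsub>rrb_H X\<^esub> y) = rrb_act X g x \<otimes>\<^bsub>rrb_H X\<^esub> rrb_act X g y"
    by (simp add: g, rule N.eq_by_multiple[OF cocycle_conditions(4)[of a a' b]]) (simp_all add: g N.m_ac)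
next
  fix g h x assume "g \<in> carrier (rrb_G X)" "h \<in> carrier (rrb_G X)" "x \<in> carrier (rrb_H X)"
  then obtain b l c m a k where g: "g = (b, l)" "h = (c, m)" "x = (a, k)"
    "b \<in> cB" "l \<in> cL" "c \<in> cB" "m \<in> cL" "a \<in> cA" "k \<in> cK"
    by auto
  show "rrb_act X (g \<otimes>\<^bsub>rrb_G X\<^esub> h) x = rrb_act X g (rrb_act X h x)"
    by (simp add: g, rule N.eq_by_multiple[OF cocycle_conditions(3)[of a b c]]) (simp_all add: g N.m_ac)
qed (auto simp: cocycle_ext_def)

lemma rrb_group_X: "rrb_group X"
proof -
  have "rrb_op X x \<otimes>\<^bsub>rrb_G X\<^esub> rrb_op X y = rrb_op X (x \<otimes>\<^bsub>rrb_H X\<^esub> rrb_act X (rrb_op X x) y)"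
    if xy: "x \<in> carrier (rrb_H X)" "y \<in> carrier (rrb_H X)" for x y
  proof -
    from xy obtain a k a' k' where g: "x = (a, k)" "y = (a', k')"
      "a \<in> cA" "k \<in> cK" "a' \<in> cA" "k' \<in> cK"
      by auto
    show ?thesis
      \<comment> \<open>The product in \<open>rrb_G X\<close> applies \<sigma> (T a') to the S-part
        of the operator at (a, k). The flipped \<open>\<sigma>_T_S\<close> brings it back under S,
        where it can cancel.\<close>
      by (simp add: g A.G.inv_mult_group flip: \<sigma>_T_S, rule L.eq_by_multiple[OF cocycle_conditions(5)[of a a', symmetric]])
        (simp_all add: g L.m_ac)
  qed
  moreover have "rrb_op X \<in> carrier (rrb_H X) \<rightarrow> carrier (rrb_G X)"
    by (auto simp: Pi_iff)
  ultimately show ?thesis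
    using group_H group_G act_X_hom unfolding rrb_group_def by blast
qed

sublocale X: rrb X
  by unfold_locales (rule rrb_group_X)

lemma rrb_extension_E: "rrb_extension A K E"
proof -
  have "(ext_i1 E, ext_i2 E) \<in> rrb_hom K X"
    by (auto simp: rrb_hom_def hom_def trivial_K)
  moreover have "(ext_p1 E, ext_p2 E) \<in> rrb_hom X A"
    by (auto simp: rrb_hom_def hom_def)
  moreover have "ext_p1 E ` carrier (rrb_H X) = cA" "ext_p2 E ` carrier (rrb_G X) = cB"
    \<comment> \<open>The units are the witnesses for surjectivity. As simp rules, the same facts
      would erase themselves from the premises.\<close>
    using N.one_closed L.one_closed by (auto simp: image_iff simp del: N.one_closed L.one_closed)
  moreover have "ext_i1 E ` cK = kernel (rrb_H X) (rrb_H A) (ext_p1 E)"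
    "ext_i2 E ` cL = kernel (rrb_G X) (rrb_G A) (ext_p2 E)"
    by (auto simp: kernel_def)
  ultimately show ?thesis
    by (simp add: rrb_extension_def rrb_group_X inj_on_def)
qed

end

text \<open>The four components of \<open>d1_RRB\<close> are precisely the four defects of the pair
  (\<psi>, \<eta>): multiplicativity of \<psi>, multiplicativity of \<eta>, compatibility with the
  actions, and compatibility with the operators.\<close>

lemma (in rrb_cocycle) cohomologous_equiv:
  assumes t: "(\<theta>1, \<theta>2) \<in> carrier C1"
    and z': "(\<tau>1', \<tau>2', \<rho>', \<chi>') = d1_RRB A K \<nu> \<mu> \<sigma> f (\<theta>1, \<theta>2) \<otimes>\<^bsub>Z2\<^esub> (\<tau>1, \<tau>2, \<rho>, \<chi>)"
  shows "rrb_ext_equiv A K (cocycle_ext A K \<nu> \<mu> \<sigma> f (\<tau>1', \<tau>2', \<rho>', \<chi>')) E"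
proof -
  interpret Z2: comm_group Z2 by (rule comm_group_Z2)
  interpret z': rrb_cocycle A K \<nu> \<mu> \<sigma> f \<tau>1' \<tau>2' \<rho>' \<chi>'
    by unfold_locales (simp only: z' Z2.m_closed[OF d1_RRB_closed[OF t] cocycle])
  have [simp]: "x \<in> cA \<Longrightarrow> \<theta>1 x \<in> cK" "b \<in> cB \<Longrightarrow> \<theta>2 b \<in> cL" "\<theta>1 1\<^sub>A = 1\<^sub>K" "\<theta>2 1\<^sub>B = 1\<^sub>L" for x b
    using t by (auto simp: C1_iff)
  have 1: "x \<in> cA \<Longrightarrow> y \<in> cA \<Longrightarrow> \<tau>1' (x, y) = \<theta>1 y \<star> invK (\<theta>1 (x \<cdot> y)) \<star> \<mu> y (\<theta>1 x) \<star> \<tau>1 (x, y)"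
    "b \<in> cB \<Longrightarrow> c \<in> cB \<Longrightarrow> \<tau>2' (b, c) = \<theta>2 c \<bullet> invL (\<theta>2 (b \<diamondop> c)) \<bullet> \<sigma> c (\<theta>2 b) \<bullet> \<tau>2 (b, c)"
    "x \<in> cA \<Longrightarrow> b \<in> cB \<Longrightarrow> \<rho>' (x, b) = \<nu> b (f (\<theta>2 b) x \<star> \<theta>1 x) \<star> invK (\<theta>1 (\<beta> b x)) \<star> \<rho> (x, b)"
    "x \<in> cA \<Longrightarrow> \<chi>' x = S (\<nu> (invB (T x)) (\<theta>1 x)) \<bullet> invL (\<theta>2 (T x)) \<bullet> \<chi> x" for x y b c
    using z' by (simp_all add: d1_RRB_def d1_def)
  define \<psi> where "\<psi> = (\<lambda>(x, k). (x, k \<star> \<theta>1 x))"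
  define \<eta> where "\<eta> = (\<lambda>(b, l). (b, l \<bullet> \<theta>2 b))"
  have "\<psi> \<in> hom (rrb_H z'.X) (rrb_H X)"
  proof (rule homI)
    fix p q assume "p \<in> carrier (rrb_H z'.X)" "q \<in> carrier (rrb_H z'.X)"
    then obtain x k y l where *: "p = (x, k)" "q = (y, l)" "x \<in> cA" "k \<in> cK" "y \<in> cA" "l \<in> cK" by auto
    show "\<psi> (p \<otimes>\<^bsub>rrb_H z'.X\<^esub> q) = \<psi> p \<otimes>\<^bsub>rrb_H X\<^esub> \<psi> q"
      by (simp add: * 1 \<psi>_def) (simp add: * N.quot_simps N.m_ac)
  qed (auto simp: \<psi>_def)
  moreover have "\<eta> \<in> hom (rrb_G z'.X) (rrb_G X)"
  proof (rule homI)
    fix p q assume "p \<in> carrier (rrb_G z'.X)" "q \<in> carrier (rrb_G z'.X)"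
    then obtain x k y l where *: "p = (x, k)" "q = (y, l)" "x \<in> cB" "k \<in> cL" "y \<in> cB" "l \<in> cL" by auto
    show "\<eta> (p \<otimes>\<^bsub>rrb_G z'.X\<^esub> q) = \<eta> p \<otimes>\<^bsub>rrb_G X\<^esub> \<eta> q"
      by (simp add: * 1 \<eta>_def) (simp add: * L.quot_simps L.m_ac)
  qed (auto simp: \<eta>_def)
  moreover have "\<eta> (rrb_op z'.X p) = rrb_op X (\<psi> p)" if "p \<in> cA \<times> cK" for p
  proof -
    from that obtain x k where *: "p = (x, k)" "x \<in> cA" "k \<in> cK" by auto
    show ?thesis
      by (simp add: * 1 \<eta>_def \<psi>_def) (simp add: * L.quot_simps L.m_ac)
  qed
  moreover have "\<psi> (rrb_act z'.X g p) = rrb_act X (\<eta> g) (\<psi> p)" if "g \<in> cB \<times> cL" "p \<in> cA \<times> cK" for g p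
  proof -
    from that obtain x k b l where *: "p = (x, k)" "x \<in> cA" "k \<in> cK" "g = (b, l)" "b \<in> cB" "l \<in> cL" by auto
    show ?thesis
      by (simp add: * 1 \<eta>_def \<psi>_def) (simp add: * N.quot_simps N.m_ac)
  qed
  ultimately have "(\<psi>, \<eta>) \<in> rrb_hom z'.X X"
    by (simp add: rrb_hom_def del: split_paired_Ball_Sigma)
  moreover have "bij_betw \<psi> (cA \<times> cK) (cA \<times> cK)"
    by (rule bij_betwI[of _ _ _ "\<lambda>(x, k). (x, k \<star> invK (\<theta>1 x))"]) (auto simp: \<psi>_def N.m_assoc)
  moreover have "bij_betw \<eta> (cB \<times> cL) (cB \<times> cL)"
    by (rule bij_betwI[of _ _ _ "\<lambda>(b, l). (b, l \<bullet> invL (\<theta>2 b))"]) (auto simp: \<eta>_def L.m_assoc)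
  ultimately show ?thesis
    unfolding rrb_ext_equiv_def by (intro exI[of _ \<psi>] exI[of _ \<eta>]) (auto simp: \<psi>_def \<eta>_def)
qed

section \<open>Cocycles of skew left braces\<close>

context rrb_mod
begin

abbreviation "Z2N \<equiv> Z2_N (induced_brace A) (induced_brace K) (xi_action A \<nu>) \<mu> (epsilon_action A K \<nu> \<mu> f)"
abbreviation "B2N \<equiv> B2_N (induced_brace A) (induced_brace K) (xi_action A \<nu>) \<mu> (epsilon_action A K \<nu> \<mu> f)"
abbreviation "CA \<equiv> cochains2 (rrb_H A) (rrb_H A) (rrb_H K)"

lemma CA_iff:
  "c \<in> carrier CA \<longleftrightarrow> c \<in> cA \<times> cA \<rightarrow>\<^sub>E cK \<and> (\<forall>a\<in>cA. c (1\<^sub>A, a) = 1\<^sub>K) \<and> (\<forall>a\<in>cA. c (a, 1\<^sub>A) = 1\<^sub>K)"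
  by (simp add: cochains2_iff)

lemma mult_Z2N [simp]:
  "(g, h) \<otimes>\<^bsub>Z2N\<^esub> (g', h') = (\<lambda>x\<in>cA \<times> cA. g x \<star> g' x, \<lambda>x\<in>cA \<times> cA. h x \<star> h' x)"
  by (simp add: Z2_N_def)

lemma one_Z2N [simp]: "\<one>\<^bsub>Z2N\<^esub> = (\<lambda>x\<in>cA \<times> cA. 1\<^sub>K, \<lambda>x\<in>cA \<times> cA. 1\<^sub>K)"
  by (simp add: Z2_N_def)

text \<open>\<open>Z2_N\<close> is cut out by equations. Their left sides form a homomorphism
  \<open>d\<close> in (g, h), since every map in them is multiplicative in the values and K is
  commutative; the solutions are its kernel.\<close>

lemma comm_group_Z2N: "comm_group Z2N"
proof -
  let ?C = "CA \<times>\<times> CA"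
  interpret C: comm_group ?C
    by (intro comm_group_DirProd comm_group_cochains2 N.comm_group_axioms)
  define P where "P = product_group (cA \<times> cA \<times> cA) (\<lambda>_. rrb_H K) \<times>\<times>
    product_group (cA \<times> cA \<times> cA) (\<lambda>_. rrb_H K) \<times>\<times> product_group (cA \<times> cA \<times> cA) (\<lambda>_. rrb_H K)"
  define d where "d = (\<lambda>(g, h).
    (\<lambda>(x, y, z)\<in>cA \<times> cA \<times> cA.
       g (y, z) \<star> invK (g (x \<cdot> y, z)) \<star> g (x, y \<cdot> z) \<star> invK (\<mu> z (g (x, y))),
     \<lambda>(x, y, z)\<in>cA \<times> cA \<times> cA.
       \<nu> (T x) (h (y, z)) \<star> invK (h (x \<cdot> \<beta> (T x) y, z)) \<star> h (x, y \<cdot> \<beta> (T y) z) \<star>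
       invK (\<nu> (T (x \<cdot> \<beta> (T x) y \<cdot> \<beta> (T (x \<cdot> \<beta> (T x) y)) z))
         (epsilon_action A K \<nu> \<mu> f z ((inv\<^bsub>AutoGroup (rrb_H K)\<^esub> \<nu> (T (x \<cdot> \<beta> (T x) y))) (h (x, y))))),
     \<lambda>(x, y, z)\<in>cA \<times> cA \<times> cA.
       \<nu> (T x) (g (y, z)) \<star> \<mu> (x \<cdot> \<beta> (T x) z) (g (x, invA x)) \<star>
       invK (\<mu> (x \<cdot> \<beta> (T x) z) (g (x \<cdot> \<beta> (T x) y, invA x))) \<star>
       invK (g (x \<cdot> \<beta> (T x) y \<cdot> invA x, x \<cdot> \<beta> (T x) z)) \<star>
       invK (\<mu> (invA x \<cdot> (x \<cdot> \<beta> (T x) z)) (h (x, y))) \<star> h (x, y \<cdot> z) \<star> invK (h (x, z))))"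
  have eps: "epsilon_action A K \<nu> \<mu> f x k =
      \<mu> (\<beta> (invB (T x)) x) (\<nu> (invB (T x)) k) \<star> \<nu> (invB (T x)) (f (S k) x)" for x k
    by (simp add: epsilon_action_def)
  have "group P"
    unfolding P_def by (intro DirProd_group product_group N.group_axioms)
  moreover have "d \<in> hom ?C P"
  proof (rule homI)
    fix c assume "c \<in> carrier ?C"
    moreover obtain g h where c: "c = (g, h)" by (cases c)
    ultimately have [simp]: "x \<in> cA \<Longrightarrow> y \<in> cA \<Longrightarrow> g (x, y) \<in> cK" "x \<in> cA \<Longrightarrow> y \<in> cA \<Longrightarrow> h (x, y) \<in> cK" for x y
      by (auto simp: CA_iff)
    show "d c \<in> carrier P"
      by (auto simp: c P_def d_def eps A.H.m_assoc)
    fix c' assume "c' \<in> carrier ?C"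
    moreover obtain g' h' where c': "c' = (g', h')" by (cases c')
    ultimately have [simp]: "x \<in> cA \<Longrightarrow> y \<in> cA \<Longrightarrow> g' (x, y) \<in> cK" "x \<in> cA \<Longrightarrow> y \<in> cA \<Longrightarrow> h' (x, y) \<in> cK" for x y
      by (auto simp: CA_iff)
    show "d (c \<otimes>\<^bsub>?C\<^esub> c') = d c \<otimes>\<^bsub>P\<^esub> d c'"
      by (simp add: c c' P_def d_def eps restrict_eq_restrict_iff A.H.m_assoc N.inv_mult, intro conjI ballI)
        (simp_all add: N.m_ac)
  qed
  ultimately have hom: "group_hom ?C P d"
    by (simp add: group_hom_def group_hom_axioms_def C.group_axioms)
  have "(g, h) \<in> carrier Z2N \<longleftrightarrow> (g, h) \<in> kernel ?C P d" for g h
    by (simp add: Z2_N_def kernel_def P_def d_def xi_action_def restrict_eq_restrict_iff) blast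
  then have "carrier Z2N = kernel ?C P d"
    by auto
  then have "Z2N = ?C\<lparr>carrier := kernel ?C P d\<rparr>"
    by (simp add: Z2_N_def)
  then show ?thesis
    using C.comm_group_subgroup[OF group_hom.subgroup_kernel[OF hom]] by simp
qed

text \<open>In the second condition the outer \<xi> cancels the inverse of \<nu> (T z) inside
  \<epsilon>. What remains is the form in which associativity of the circle product in an extension
  arises.\<close>

lemma Z2N_iff:
  "(g, h) \<in> carrier Z2N \<longleftrightarrow> g \<in> carrier CA \<and> h \<in> carrier CA \<and>
     (\<forall>x\<in>cA. \<forall>y\<in>cA. \<forall>z\<in>cA.
        g (y, z) \<star> g (x, y \<cdot> z) = g (x \<cdot> y, z) \<star> \<mu> z (g (x, y)) \<and>
        \<nu> (T x) (h (y, z)) \<star> h (x, y \<cdot> \<beta> (T y) z) = h (x \<cdot> \<beta> (T x) y, z) \<star>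
          (\<mu> (\<beta> (T x) (\<beta> (T y) z)) (h (x, y)) \<star>
           \<nu> (T x) (\<nu> (T y) (f (S (\<nu> (invB (T y)) (\<nu> (invB (T x)) (h (x, y))))) z))) \<and>
        \<nu> (T x) (g (y, z)) \<star> \<mu> (x \<cdot> \<beta> (T x) z) (g (x, invA x)) \<star> h (x, y \<cdot> z) =
          \<mu> (x \<cdot> \<beta> (T x) z) (g (x \<cdot> \<beta> (T x) y, invA x)) \<star>
          g (x \<cdot> \<beta> (T x) y \<cdot> invA x, x \<cdot> \<beta> (T x) z) \<star>
          \<mu> (invA x \<cdot> (x \<cdot> \<beta> (T x) z)) (h (x, y)) \<star> h (x, z))"
proof (cases "g \<in> carrier CA \<and> h \<in> carrier CA")
  case True
  then have [simp]: "x \<in> cA \<Longrightarrow> y \<in> cA \<Longrightarrow> g (x, y) \<in> cK" "x \<in> cA \<Longrightarrow> y \<in> cA \<Longrightarrow> h (x, y) \<in> cK" for x y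
    by (auto simp: CA_iff)
  from True show ?thesis
    unfolding Z2_N_def
    apply (simp add: xi_action_def epsilon_action_def A.H.m_assoc A.G.inv_mult_group)
    apply (intro ball_cong refl conj_cong)
      apply (simp_all add: N.quot_simps N.m_ac)
    done
next
  case False
  then show ?thesis
    by (auto simp: Z2_N_def)
qed

lemma B2N_iff:
  "(g, h) \<in> B2N \<longleftrightarrow> (g, h) \<in> carrier Z2N \<and>
     (\<exists>\<theta>\<in>cA \<rightarrow> cK. \<forall>x\<in>cA. \<forall>y\<in>cA.
       g (x, y) = \<nu> (T (x \<cdot> y)) (invK (\<theta> (x \<cdot> y))) \<star> \<mu> y (\<nu> (T x) (\<theta> x)) \<star> \<nu> (T y) (\<theta> y) \<and>
       h (x, y) = \<nu> (T x \<diamondop> T y) (invK (\<theta> (x \<cdot> \<beta> (T x) y)) \<star>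
         (\<mu> (\<beta> (invB (T y)) y) (\<nu> (invB (T y)) (\<theta> x)) \<star> \<nu> (invB (T y)) (f (S (\<theta> x)) y)) \<star> \<theta> y))" 
  by (auto simp: B2_N_def xi_action_def epsilon_action_def intro!: ball_cong bex_cong)

text \<open>\<open>B2_N\<close> is given by the existence of \<theta> inside \<open>Z2_N\<close>,
  not as the image of a cochain group, so the subgroup laws are checked directly. The formulas are
  multiplicative in \<theta>, hence the witnesses 1, the pointwise inverse and the pointwise
  product.\<close>

lemma B2N_normal: "B2N \<lhd> Z2N"
proof -
  interpret Z: comm_group Z2N by (rule comm_group_Z2N)
  have closed [simp]: "x \<in> cA \<Longrightarrow> y \<in> cA \<Longrightarrow> g (x, y) \<in> cK" "x \<in> cA \<Longrightarrow> y \<in> cA \<Longrightarrow> h (x, y) \<in> cK"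
    if "(g, h) \<in> carrier Z2N" for g h x y
    using that by (auto simp: Z2N_iff CA_iff)
  have "subgroup B2N Z2N"
  proof (rule Z.subgroupI)
    show "B2N \<subseteq> carrier Z2N"
      using B2N_iff by auto
    have "\<one>\<^bsub>Z2N\<^esub> \<in> B2N"
      using Z.one_closed by (simp add: B2N_iff) (rule bexI[of _ "\<lambda>_. 1\<^sub>K"], auto)
    then show "B2N \<noteq> {}"
      by blast
  next
    fix c assume "c \<in> B2N"
    moreover obtain g h where c: "c = (g, h)" by (cases c)
    ultimately obtain \<theta> where gh: "(g, h) \<in> carrier Z2N" and \<theta>: "\<theta> \<in> cA \<rightarrow> cK"
      and *: "\<And>x y. x \<in> cA \<Longrightarrow> y \<in> cA \<Longrightarrow>
       g (x, y) = \<nu> (T (x \<cdot> y)) (invK (\<theta> (x \<cdot> y))) \<star> \<mu> y (\<nu> (T x) (\<theta> x)) \<star> \<nu> (T y) (\<theta> y) \<and>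
       h (x, y) = \<nu> (T x \<diamondop> T y) (invK (\<theta> (x \<cdot> \<beta> (T x) y)) \<star>
         (\<mu> (\<beta> (invB (T y)) y) (\<nu> (invB (T y)) (\<theta> x)) \<star> \<nu> (invB (T y)) (f (S (\<theta> x)) y)) \<star> \<theta> y)"
      using B2N_iff by auto
    have [simp]: "x \<in> cA \<Longrightarrow> \<theta> x \<in> cK" for x
      using \<theta> by auto
    \<comment> \<open>The inverse in \<open>Z2N\<close> is known only abstractly. Its values are
      recovered by reading the law of the left inverse pointwise.\<close>
    obtain g' h' where c': "inv\<^bsub>Z2N\<^esub> c = (g', h')"
      by (cases "inv\<^bsub>Z2N\<^esub> c")
    have gh': "(g', h') \<in> carrier Z2N"
      using gh unfolding c'[symmetric] c by simp
    have "(g', h') \<otimes>\<^bsub>Z2N\<^esub> (g, h) = \<one>\<^bsub>Z2N\<^esub>"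
      using gh unfolding c'[symmetric] c by (rule Z.l_inv)
    then have "g' (x, y) \<star> g (x, y) = 1\<^sub>K" "h' (x, y) \<star> h (x, y) = 1\<^sub>K" if "x \<in> cA" "y \<in> cA" for x y
      using that by (auto simp: restrict_eq_restrict_iff)
    then have "g' (x, y) = invK (g (x, y)) \<and> h' (x, y) = invK (h (x, y))" if "x \<in> cA" "y \<in> cA" for x y
      using that gh gh' by (metis N.inv_equality closed)
    then have "(g', h') \<in> B2N"
      unfolding B2N_iff using gh' *
      by (intro conjI bexI[of _ "\<lambda>x. invK (\<theta> x)"]) (auto simp: N.inv_mult N.m_ac)
    then show "inv\<^bsub>Z2N\<^esub> c \<in> B2N"
      by (simp add: c')
  next
    fix c c' assume "c \<in> B2N" "c' \<in> B2N"
    moreover obtain g h g' h' where c: "c = (g, h)" "c' = (g', h')" by (cases c, cases c')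
    ultimately obtain \<theta> \<theta>' where gh: "(g, h) \<in> carrier Z2N" "(g', h') \<in> carrier Z2N"
      and \<theta>: "\<theta> \<in> cA \<rightarrow> cK" "\<theta>' \<in> cA \<rightarrow> cK"
      and *: "\<And>x y. x \<in> cA \<Longrightarrow> y \<in> cA \<Longrightarrow>
       g (x, y) = \<nu> (T (x \<cdot> y)) (invK (\<theta> (x \<cdot> y))) \<star> \<mu> y (\<nu> (T x) (\<theta> x)) \<star> \<nu> (T y) (\<theta> y) \<and>
       h (x, y) = \<nu> (T x \<diamondop> T y) (invK (\<theta> (x \<cdot> \<beta> (T x) y)) \<star>
         (\<mu> (\<beta> (invB (T y)) y) (\<nu> (invB (T y)) (\<theta> x)) \<star> \<nu> (invB (T y)) (f (S (\<theta> x)) y)) \<star> \<theta> y)"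
      "\<And>x y. x \<in> cA \<Longrightarrow> y \<in> cA \<Longrightarrow>
       g' (x, y) = \<nu> (T (x \<cdot> y)) (invK (\<theta>' (x \<cdot> y))) \<star> \<mu> y (\<nu> (T x) (\<theta>' x)) \<star> \<nu> (T y) (\<theta>' y) \<and>
       h' (x, y) = \<nu> (T x \<diamondop> T y) (invK (\<theta>' (x \<cdot> \<beta> (T x) y)) \<star>
         (\<mu> (\<beta> (invB (T y)) y) (\<nu> (invB (T y)) (\<theta>' x)) \<star> \<nu> (invB (T y)) (f (S (\<theta>' x)) y)) \<star> \<theta>' y)"
      using B2N_iff by auto
    have [simp]: "x \<in> cA \<Longrightarrow> \<theta> x \<in> cK" "x \<in> cA \<Longrightarrow> \<theta>' x \<in> cK" for x
      using \<theta> by auto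
    have "(g, h) \<otimes>\<^bsub>Z2N\<^esub> (g', h') \<in> carrier Z2N"
      using gh by (rule Z.m_closed)
    then show "c \<otimes>\<^bsub>Z2N\<^esub> c' \<in> B2N"
      unfolding c mult_Z2N B2N_iff using *
      by (intro conjI bexI[of _ "\<lambda>x. \<theta> x \<star> \<theta>' x"]) (auto simp: N.inv_mult N.m_ac)
  qed
  then show ?thesis
    by (rule Z.subgroup_imp_normal)
qed

end

text \<open>It is defined on arbitrary quadruples and outside \<open>rrb_cocycle\<close>, so that it
  can be applied to products of cocycles.\<close>

definition (in rrb_mod) brace_cochain where
  "brace_cochain = (\<lambda>(\<tau>1, \<tau>2, \<rho>, \<chi>).
     (\<tau>1, \<lambda>(x, y)\<in>cA \<times> cA. \<tau>1 (x, \<beta> (T x) y) \<star> \<rho> (y, T x) \<star> \<nu> (T x) (f (\<chi> x) y)))"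

context rrb_cocycle
begin

definition h where
  "h = (\<lambda>(x, y)\<in>cA \<times> cA. \<tau>1 (x, \<beta> (T x) y) \<star> \<rho> (y, T x) \<star> \<nu> (T x) (f (\<chi> x) y))"

lemma brace_cochain_eq: "brace_cochain (\<tau>1, \<tau>2, \<rho>, \<chi>) = (\<tau>1, h)"
  by (simp add: brace_cochain_def h_def)

lemma h_closed [simp]: "x \<in> cA \<Longrightarrow> y \<in> cA \<Longrightarrow> h (x, y) \<in> cK"
  by (simp add: h_def)

lemma h_CA: "h \<in> carrier CA"
  by (auto simp: CA_iff h_def)

text \<open>The cocycle h is the value at k = l = 1. The part depending on k is \<epsilon> at y,
  conjugated by \<xi>: apply the inverse of \<xi> at x, then \<epsilon>, then \<xi> at x circ y.
  This is where the formula for \<epsilon> comes from.\<close>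

lemma circ_X:
  assumes "x \<in> cA" "k \<in> cK" "y \<in> cA" "l \<in> cK"
  shows "(x, k) \<otimes>\<^bsub>rrb_H X\<^esub> rrb_act X (rrb_op X (x, k)) (y, l) =
    (x \<cdot> \<beta> (T x) y, h (x, y) \<star>
      (\<mu> (\<beta> (T x) y) k \<star> \<nu> (T x) (f (S (\<nu> (invB (T x)) k)) y) \<star> \<nu> (T x) l))"
  using assms by (simp add: h_def N.m_ac)

text \<open>The conditions are associativity of \<open>\<circ>\<close> and the brace identity in the extension, evaluated at the
  elements \<open>(x, 1)\<close>.\<close>

lemma brace_cochain_closed: "(\<tau>1, h) \<in> carrier Z2N"
proof -
  have c0: "\<tau>1 \<in> carrier CA"
    using cocycle by (auto simp: Z2_iff C2_iff CA_iff)
  have c2: "\<nu> (T x) (h (y, z)) \<star> h (x, y \<cdot> \<beta> (T y) z) = h (x \<cdot> \<beta> (T x) y, z) \<star>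
          (\<mu> (\<beta> (T x) (\<beta> (T y) z)) (h (x, y)) \<star>
           \<nu> (T x) (\<nu> (T y) (f (S (\<nu> (invB (T y)) (\<nu> (invB (T x)) (h (x, y))))) z)))"
    if [simp]: "x \<in> cA" "y \<in> cA" "z \<in> cA" for x y z
  proof -
    let ?e = "\<lambda>x. (x, 1\<^sub>K)"
    have "?e x \<otimes>\<^bsub>rrb_H X\<^esub> rrb_act X (rrb_op X (?e x)) (?e y \<otimes>\<^bsub>rrb_H X\<^esub> rrb_act X (rrb_op X (?e y)) (?e z)) =
      (?e x \<otimes>\<^bsub>rrb_H X\<^esub> rrb_act X (rrb_op X (?e x)) (?e y)) \<otimes>\<^bsub>rrb_H X\<^esub>
        rrb_act X (rrb_op X (?e x \<otimes>\<^bsub>rrb_H X\<^esub> rrb_act X (rrb_op X (?e x)) (?e y))) (?e z)"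
      by (rule X.circ_assoc) simp_all
    then show ?thesis
      \<comment> \<open>Without the rules for product, action and operator, \<open>circ_X\<close>
        rewrites each circle product as a whole, and h stays folded.\<close>
      by (simp add: circ_X A.G.inv_mult_group N.m_ac del: X_simps(3,7,8))
  qed
  have c3: "\<nu> (T x) (\<tau>1 (y, z)) \<star> \<mu> (x \<cdot> \<beta> (T x) z) (\<tau>1 (x, invA x)) \<star> h (x, y \<cdot> z) =
          \<mu> (x \<cdot> \<beta> (T x) z) (\<tau>1 (x \<cdot> \<beta> (T x) y, invA x)) \<star>
          \<tau>1 (x \<cdot> \<beta> (T x) y \<cdot> invA x, x \<cdot> \<beta> (T x) z) \<star>
          \<mu> (invA x \<cdot> (x \<cdot> \<beta> (T x) z)) (h (x, y)) \<star> h (x, z)"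
    if [simp]: "x \<in> cA" "y \<in> cA" "z \<in> cA" for x y z
  proof -
    \<comment> \<open>Opaque names keep \<mu> at these circle products from being split into two
      applications.\<close>
    define u where "u = x \<cdot> \<beta> (T x) y"
    define v where "v = x \<cdot> \<beta> (T x) z"
    have [simp]: "u \<in> cA" "v \<in> cA" by (simp_all add: u_def v_def)
    \<comment> \<open>Multiplying (x, 1) by its candidate inverse in this order lets \<mu> act only
      on the unit and produces \<tau>1 (x, inv x), the value that occurs in the third
      condition.\<close>
    have "inv\<^bsub>rrb_H X\<^esub> (invA x, invK (\<tau>1 (x, invA x))) = (x, 1\<^sub>K)"
      by (rule X.H.inv_equality) simp_all
    then have inv: "inv\<^bsub>rrb_H X\<^esub> (x, 1\<^sub>K) = (invA x, invK (\<tau>1 (x, invA x)))"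
      using X.H.inv_inv[of "(invA x, invK (\<tau>1 (x, invA x)))"] by simp
    have "(x, 1\<^sub>K) \<otimes>\<^bsub>rrb_H X\<^esub> rrb_act X (rrb_op X (x, 1\<^sub>K)) ((y, 1\<^sub>K) \<otimes>\<^bsub>rrb_H X\<^esub> (z, 1\<^sub>K)) =
        ((x, 1\<^sub>K) \<otimes>\<^bsub>rrb_H X\<^esub> rrb_act X (rrb_op X (x, 1\<^sub>K)) (y, 1\<^sub>K)) \<otimes>\<^bsub>rrb_H X\<^esub>
        inv\<^bsub>rrb_H X\<^esub> (x, 1\<^sub>K) \<otimes>\<^bsub>rrb_H X\<^esub>
        ((x, 1\<^sub>K) \<otimes>\<^bsub>rrb_H X\<^esub> rrb_act X (rrb_op X (x, 1\<^sub>K)) (z, 1\<^sub>K))"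
      by (rule X.circ_mult) simp_all
    then show ?thesis
      by (simp add: inv circ_X u_def[symmetric] v_def[symmetric] del: X_simps(7,8)) (simp add: N.quot_simps N.m_ac)
  qed
  show ?thesis
    unfolding Z2N_iff by (intro conjI ballI c0 h_CA cocycle_conditions(1) c2 c3)
qed

end

context rrb_mod
begin

lemma rrb_cocycleI:
  "(\<tau>1, \<tau>2, \<rho>, \<chi>) \<in> carrier Z2 \<Longrightarrow> rrb_cocycle A K \<nu> \<mu> \<sigma> f \<tau>1 \<tau>2 \<rho> \<chi>"
  by unfold_locales

lemma brace_cochain_hom: "brace_cochain \<in> hom Z2 Z2N"
proof (rule homI)
  fix z assume z: "z \<in> carrier Z2"
  obtain \<tau>1 \<tau>2 \<rho> \<chi> where z_eq: "z = (\<tau>1, \<tau>2, \<rho>, \<chi>)" by (cases z)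
  interpret z: rrb_cocycle A K \<nu> \<mu> \<sigma> f \<tau>1 \<tau>2 \<rho> \<chi>
    using z unfolding z_eq by (rule rrb_cocycleI)
  show "brace_cochain z \<in> carrier Z2N"
    unfolding z_eq z.brace_cochain_eq by (rule z.brace_cochain_closed)
  fix z' assume z': "z' \<in> carrier Z2"
  obtain \<tau>1' \<tau>2' \<rho>' \<chi>' where z'_eq: "z' = (\<tau>1', \<tau>2', \<rho>', \<chi>')" by (cases z')
  interpret z': rrb_cocycle A K \<nu> \<mu> \<sigma> f \<tau>1' \<tau>2' \<rho>' \<chi>'
    using z' unfolding z'_eq by (rule rrb_cocycleI)
  show "brace_cochain (z \<otimes>\<^bsub>Z2\<^esub> z') = brace_cochain z \<otimes>\<^bsub>Z2N\<^esub> brace_cochain z'"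
    by (simp add: z_eq z'_eq brace_cochain_def restrict_eq_restrict_iff N.m_ac)
qed

text \<open>The component \<theta>2 leaves no trace: in h, the factor f (\<theta>2 (T x)) y from
  \<rho> cancels against its inverse, which comes from f (\<chi> x) y.\<close>

lemma brace_cochain_coboundary:
  assumes t: "(\<theta>1, \<theta>2) \<in> carrier C1"
  shows "brace_cochain (d1_RRB A K \<nu> \<mu> \<sigma> f (\<theta>1, \<theta>2)) \<in> B2N"
proof -
  have [simp]: "x \<in> cA \<Longrightarrow> \<theta>1 x \<in> cK" "b \<in> cB \<Longrightarrow> \<theta>2 b \<in> cL" "\<theta>1 1\<^sub>A = 1\<^sub>K" "\<theta>2 1\<^sub>B = 1\<^sub>L" for x b
    using t by (auto simp: C1_iff)
  obtain g h where gh: "brace_cochain (d1_RRB A K \<nu> \<mu> \<sigma> f (\<theta>1, \<theta>2)) = (g, h)"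
    by (cases "brace_cochain (d1_RRB A K \<nu> \<mu> \<sigma> f (\<theta>1, \<theta>2))")
  have "(g, h) \<in> carrier Z2N"
    using brace_cochain_hom d1_RRB_closed[OF t] unfolding gh[symmetric] hom_def by auto
  moreover have "g (x, y) = \<nu> (T (x \<cdot> y)) (invK (\<nu> (invB (T (x \<cdot> y))) (\<theta>1 (x \<cdot> y)))) \<star>
      \<mu> y (\<nu> (T x) (\<nu> (invB (T x)) (\<theta>1 x))) \<star> \<nu> (T y) (\<nu> (invB (T y)) (\<theta>1 y))"
    if "x \<in> cA" "y \<in> cA" for x y
  proof -
    have "g (x, y) = d1 (rrb_H A) (rrb_H K) \<mu> \<theta>1 (x, y)"
      using gh by (auto simp: brace_cochain_def d1_RRB_def)
    then show ?thesis
      using that by (simp add: d1_def N.m_ac)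
  qed
  moreover have "h (x, y) = \<nu> (T x \<diamondop> T y) (invK (\<nu> (invB (T (x \<cdot> \<beta> (T x) y))) (\<theta>1 (x \<cdot> \<beta> (T x) y))) \<star>
         (\<mu> (\<beta> (invB (T y)) y) (\<nu> (invB (T y)) (\<nu> (invB (T x)) (\<theta>1 x))) \<star>
          \<nu> (invB (T y)) (f (S (\<nu> (invB (T x)) (\<theta>1 x))) y)) \<star> \<nu> (invB (T y)) (\<theta>1 y))"
    if "x \<in> cA" "y \<in> cA" for x y
  proof -
    have "h = snd (brace_cochain (d1_RRB A K \<nu> \<mu> \<sigma> f (\<theta>1, \<theta>2)))"
      by (simp add: gh)
    then show ?thesis
      using that
      apply (simp add: brace_cochain_def d1_RRB_def d1_def A.G.inv_mult_group)
      apply (simp add: N.quot_simps N.m_ac)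
      done
  qed
  ultimately show ?thesis
    unfolding gh B2N_iff by (intro conjI bexI[of _ "\<lambda>x. \<nu> (invB (T x)) (\<theta>1 x)"] ballI) auto
qed

end

section \<open>Sections of the extension defined by a cocycle\<close>

context rrb_cocycle
begin

lemma brace_extension_E: "brace_extension (induced_brace A) (induced_brace K) (induced_brace_ext E)"
  using rrb_extension_E rrb_K by (rule brace_extension_induced)

text \<open>Right multiplication by (1, l) multiplies the second component by l, because \<tau>1 (x,
  1) = 1 and \<mu> at 1 is the identity. The kernel part of two elements over the same x is thus
  read off without computing an inverse.\<close>

lemma inv_into_i1:
  assumes "x \<in> cA" "k \<in> cK" "l \<in> cK"
  shows "inv_into cK (\<lambda>k. (1\<^sub>A, k)) (inv\<^bsub>rrb_H X\<^esub> (x, k) \<otimes>\<^bsub>rrb_H X\<^esub> (x, k \<star> l)) = l"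
proof -
  have "(x, k \<star> l) = (x, k) \<otimes>\<^bsub>rrb_H X\<^esub> (1\<^sub>A, l)"
    using assms by simp
  then have "inv\<^bsub>rrb_H X\<^esub> (x, k) \<otimes>\<^bsub>rrb_H X\<^esub> (x, k \<star> l) = (1\<^sub>A, l)"
    using assms X.H.inv_solve_left'[of "(1\<^sub>A, l)" "(x, k)" "(x, k \<star> l)"] by simp
  then show ?thesis
    using assms by (simp add: inv_into_f_f inj_on_def)
qed

text \<open>Replacing the section \<open>x \<mapsto> (x, 1)\<close> by \<open>x \<mapsto> (x, \<theta> x)\<close> multiplies the cocycle by the coboundary of
  \<open>(\<theta>, 1)\<close>, and the coset of \<open>brace_cochain\<close> does not see this.\<close>

lemma section_cocycle_E:
  assumes s: "normalized_section (induced_brace A) (induced_brace_ext E) s"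
  shows "B2N #>\<^bsub>Z2N\<^esub> section_cocycle (induced_brace A) (induced_brace K) (induced_brace_ext E) s
    = B2N #>\<^bsub>Z2N\<^esub> brace_cochain (\<tau>1, \<tau>2, \<rho>, \<chi>)"
proof -
  interpret Z: comm_group Z2N by (rule comm_group_Z2N)
  interpret B: normal B2N Z2N by (rule B2N_normal)
  define \<theta> where "\<theta> = (\<lambda>x\<in>cA. snd (s x))"
  have *: "s x \<in> cA \<times> cK" "fst (s x) = x" if "x \<in> cA" for x
    using s that by (auto simp: normalized_section_def induced_brace_ext_def)
  have s_eq: "s x = (x, \<theta> x)" and [simp]: "\<theta> x \<in> cK" if "x \<in> cA" for x
    using *[OF that] that by (auto simp: \<theta>_def prod_eq_iff)
  have "s 1\<^sub>A = (1\<^sub>A, 1\<^sub>K)"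
    using s by (simp add: normalized_section_def induced_brace_ext_def)
  then have \<theta>_one: "\<theta> 1\<^sub>A = 1\<^sub>K"
    by (simp add: \<theta>_def)
  have \<theta>_ext: "\<theta> \<in> extensional cA"
    by (simp add: \<theta>_def)
  let ?t = "(\<theta>, \<lambda>b\<in>cB. 1\<^sub>L)"
  let ?d = "d1_RRB A K \<nu> \<mu> \<sigma> f ?t"
  have t: "?t \<in> carrier C1"
    using \<theta>_one \<theta>_ext by (auto simp: C1_iff PiE_iff)
  have "section_cocycle (induced_brace A) (induced_brace K) (induced_brace_ext E) s
      = brace_cochain (?d \<otimes>\<^bsub>Z2\<^esub> (\<tau>1, \<tau>2, \<rho>, \<chi>))"
  proof -
    have "inv_into cK (\<lambda>k. (1\<^sub>A, k)) (inv\<^bsub>rrb_H X\<^esub> (s (x \<cdot> y)) \<otimes>\<^bsub>rrb_H X\<^esub> (s x \<otimes>\<^bsub>rrb_H X\<^esub> s y)) =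
        \<theta> y \<star> invK (\<theta> (x \<cdot> y)) \<star> \<mu> y (\<theta> x) \<star> \<tau>1 (x, y)" (is "_ = ?v")
      if [simp]: "x \<in> cA" "y \<in> cA" for x y
    proof -
      \<comment> \<open>Splitting off \<theta> (x \<cdot> y), the second component of s (x \<cdot>
        y), puts the product into the shape required by \<open>inv_into_i1\<close>.\<close>
      have "s x \<otimes>\<^bsub>rrb_H X\<^esub> s y = (x \<cdot> y, \<theta> (x \<cdot> y) \<star> ?v)"
        by (simp add: s_eq) (simp add: N.quot_simps N.m_ac)
      then show ?thesis
        by (simp add: s_eq[of "x \<cdot> y"] inv_into_i1 del: X_simps(3))
    qed
    moreover have "inv_into cK (\<lambda>k. (1\<^sub>A, k)) (inv\<^bsub>rrb_H X\<^esub> (s (x \<cdot> \<beta> (T x) y)) \<otimes>\<^bsub>rrb_H X\<^esub>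
          (s x \<otimes>\<^bsub>rrb_H X\<^esub> rrb_act X (rrb_op X (s x)) (s y))) =
        invK (\<theta> (x \<cdot> \<beta> (T x) y)) \<star> h (x, y) \<star>
          (\<mu> (\<beta> (T x) y) (\<theta> x) \<star> \<nu> (T x) (f (S (\<nu> (invB (T x)) (\<theta> x))) y) \<star> \<nu> (T x) (\<theta> y))" (is "_ = ?v")
      if [simp]: "x \<in> cA" "y \<in> cA" for x y
    proof -
      have "s x \<otimes>\<^bsub>rrb_H X\<^esub> rrb_act X (rrb_op X (s x)) (s y) = (x \<cdot> \<beta> (T x) y, \<theta> (x \<cdot> \<beta> (T x) y) \<star> ?v)"
        by (simp add: s_eq circ_X del: X_simps(3,7,8)) (simp add: N.quot_simps N.m_ac)
      then show ?thesis
        by (simp add: s_eq[of "x \<cdot> \<beta> (T x) y"] inv_into_i1 del: X_simps(3,7,8))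
    qed
    moreover have "\<theta> y \<star> invK (\<theta> (x \<cdot> y)) \<star> \<mu> y (\<theta> x) \<star> \<tau>1 (x, y) = fst (brace_cochain (?d \<otimes>\<^bsub>Z2\<^esub> (\<tau>1, \<tau>2, \<rho>, \<chi>))) (x, y)"
      "invK (\<theta> (x \<cdot> \<beta> (T x) y)) \<star> h (x, y) \<star>
          (\<mu> (\<beta> (T x) y) (\<theta> x) \<star> \<nu> (T x) (f (S (\<nu> (invB (T x)) (\<theta> x))) y) \<star> \<nu> (T x) (\<theta> y))
       = snd (brace_cochain (?d \<otimes>\<^bsub>Z2\<^esub> (\<tau>1, \<tau>2, \<rho>, \<chi>))) (x, y)"
      if [simp]: "x \<in> cA" "y \<in> cA" for x y
       apply (simp add: brace_cochain_def d1_RRB_def d1_def)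
       apply (simp add: brace_cochain_def h_def d1_RRB_def d1_def)
      apply (simp add: N.quot_simps N.m_ac)
      done
    moreover have "fst (brace_cochain (?d \<otimes>\<^bsub>Z2\<^esub> (\<tau>1, \<tau>2, \<rho>, \<chi>))) \<in> extensional (cA \<times> cA)"
      "snd (brace_cochain (?d \<otimes>\<^bsub>Z2\<^esub> (\<tau>1, \<tau>2, \<rho>, \<chi>))) \<in> extensional (cA \<times> cA)"
      by (simp_all add: brace_cochain_def d1_RRB_def)
    ultimately show ?thesis
      by (auto simp: section_cocycle_def induced_brace_ext_def prod_eq_iff fun_eq_iff extensional_def
          simp del: X_simps(3,7,8) mult_Z2)
  qed
  also have "\<dots> = brace_cochain ?d \<otimes>\<^bsub>Z2N\<^esub> brace_cochain (\<tau>1, \<tau>2, \<rho>, \<chi>)"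
    using brace_cochain_hom d1_RRB_closed[OF t] cocycle by (simp only: hom_mult)
  finally have eq: "section_cocycle (induced_brace A) (induced_brace K) (induced_brace_ext E) s = \<dots>" .
  have "brace_cochain ?d \<in> B2N" "brace_cochain (\<tau>1, \<tau>2, \<rho>, \<chi>) \<in> carrier Z2N"
    using brace_cochain_coboundary[OF t] brace_cochain_closed by (simp_all add: brace_cochain_eq)
  then show ?thesis
    unfolding eq by (simp add: B.subset B.subgroup_axioms Z.coset_join2 flip: Z.coset_mult_assoc)
qed

end

section \<open>The three maps evaluated on classes\<close>

context rrb_mod
begin

lemma cocycle_ext_extension: "z \<in> carrier Z2 \<Longrightarrow> rrb_extension A K (cocycle_ext A K \<nu> \<mu> \<sigma> f z)"
  by (cases z) (simp add: rrb_cocycle.rrb_extension_E rrb_cocycleI)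

lemma cocycle_ext_equiv:
  assumes z: "z \<in> carrier Z2" and z': "z' \<in> B2 #>\<^bsub>Z2\<^esub> z"
  shows "rrb_ext_equiv A K (cocycle_ext A K \<nu> \<mu> \<sigma> f z') (cocycle_ext A K \<nu> \<mu> \<sigma> f z)"
proof -
  obtain \<tau>1 \<tau>2 \<rho> \<chi> where z_eq: "z = (\<tau>1, \<tau>2, \<rho>, \<chi>)" by (cases z)
  obtain \<tau>1' \<tau>2' \<rho>' \<chi>' where z'_eq: "z' = (\<tau>1', \<tau>2', \<rho>', \<chi>')" by (cases z')
  obtain \<theta>1 \<theta>2 where "(\<theta>1, \<theta>2) \<in> carrier C1" "z' = d1_RRB A K \<nu> \<mu> \<sigma> f (\<theta>1, \<theta>2) \<otimes>\<^bsub>Z2\<^esub> z"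
    using z' by (auto simp: r_coset_def B2_RRB_def)
  with z show ?thesis
    unfolding z_eq z'_eq by (intro rrb_cocycle.cohomologous_equiv[OF rrb_cocycleI])
qed

lemma Psi_eq:
  assumes z: "z \<in> carrier Z2"
  shows "Psi A K \<nu> \<mu> \<sigma> f (B2 #>\<^bsub>Z2\<^esub> z) = rrb_ext_class A K (cocycle_ext A K \<nu> \<mu> \<sigma> f z)"
proof -
  interpret Z2: comm_group Z2 by (rule comm_group_Z2)
  interpret B2: normal B2 Z2 by (rule B2_normal)
  note refl = Z2.rcos_self[OF _ B2.subgroup_axioms]
  have "rrb_ext_class A K (cocycle_ext A K \<nu> \<mu> \<sigma> f z') = rrb_ext_class A K (cocycle_ext A K \<nu> \<mu> \<sigma> f z)"
    if z': "z' \<in> B2 #>\<^bsub>Z2\<^esub> z" for z'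
  proof -
    \<comment> \<open>Equality of the classes needs an equivalence in each direction. Exchanging z
      and z' in the coset relation yields the second one.\<close>
    have "z' \<in> carrier Z2" and "z \<in> B2 #>\<^bsub>Z2\<^esub> z'"
      using z z' refl[OF z] Z2.repr_independence[OF z' z B2.subgroup_axioms]
        Z2.r_coset_subset_G[OF B2.subset z] by auto
    then show ?thesis
      using cocycle_ext_equiv[OF z z'] cocycle_ext_equiv[of z' z] rrb_ext_equiv_trans
      unfolding rrb_ext_class_def by blast
  qed
  then show ?thesis
    unfolding Psi_def using refl[OF z] by (intro the_elem_image_eq)
qed

text \<open>Reflexivity places E in its own class, so that \<open>the_elem\<close> has a value. For
  the extension of a cocycle z it is supplied by \<open>cocycle_ext_equiv\<close> with z' =
  z.\<close>

lemma Pi_map_eq: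
  assumes E: "rrb_extension A K E" and refl: "rrb_ext_equiv A K E E"
  shows "Pi_map A K (rrb_ext_class A K E) =
    brace_ext_class (induced_brace A) (induced_brace K) (induced_brace_ext E)"
  unfolding Pi_map_def
proof (rule the_elem_image_eq)
  show "E \<in> rrb_ext_class A K E"
    using E refl by (simp add: rrb_ext_class_def)
  fix F assume "F \<in> rrb_ext_class A K E"
  then have "brace_ext_equiv (induced_brace A) (induced_brace K) (induced_brace_ext E) (induced_brace_ext F)"
    using E by (intro brace_ext_equiv_induced) (auto simp: rrb_ext_class_def rrb_extension_def)
  moreover from this
  have "brace_ext_equiv (induced_brace A) (induced_brace K) (induced_brace_ext F) (induced_brace_ext E)"
    by (rule brace_ext_equiv_sym[OF brace_extension_induced[OF E rrb_K]])
  ultimately show "brace_ext_class (induced_brace A) (induced_brace K) (induced_brace_ext F) =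
      brace_ext_class (induced_brace A) (induced_brace K) (induced_brace_ext E)"
    using brace_ext_equiv_trans unfolding brace_ext_class_def by blast
qed

text \<open>An arbitrary extension in the class is replaced by that of z through transport of the
  section. Then \<open>section_cocycle_E\<close> removes the dependence on the section.\<close>

lemma Lambda_eq:
  assumes z: "z \<in> carrier Z2"
  shows "Lambda (induced_brace A) (induced_brace K) (xi_action A \<nu>) \<mu> (epsilon_action A K \<nu> \<mu> f)
      (brace_ext_class (induced_brace A) (induced_brace K) (induced_brace_ext (cocycle_ext A K \<nu> \<mu> \<sigma> f z)))
    = B2N #>\<^bsub>Z2N\<^esub> brace_cochain z"
proof -
  obtain \<tau>1 \<tau>2 \<rho> \<chi> where z_eq: "z = (\<tau>1, \<tau>2, \<rho>, \<chi>)" by (cases z)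
  interpret z: rrb_cocycle A K \<nu> \<mu> \<sigma> f \<tau>1 \<tau>2 \<rho> \<chi>
    using z unfolding z_eq by (rule rrb_cocycleI)
  let ?M = "induced_brace A" and ?I = "induced_brace K"
  let ?E = "induced_brace_ext z.E"
  have sec: "B2N #>\<^bsub>Z2N\<^esub> section_cocycle ?M ?I F s = B2N #>\<^bsub>Z2N\<^esub> brace_cochain z"
    if F: "F \<in> brace_ext_class ?M ?I ?E" and s: "normalized_section ?M F s" for F s
  proof -
    have "brace_extension ?M ?I F" "brace_ext_equiv ?M ?I F ?E"
      using F brace_ext_equiv_sym[OF z.brace_extension_E] by (auto simp: brace_ext_class_def)
    then obtain t where "normalized_section ?M ?E t" "section_cocycle ?M ?I ?E t = section_cocycle ?M ?I F s"
      using section_cocycle_equiv z.brace_extension_E A.skew_left_brace_induced s by metis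
    then show ?thesis
      using z.section_cocycle_E by (metis z_eq)
  qed
  have "?E \<in> brace_ext_class ?M ?I ?E"
    using z.brace_extension_E brace_ext_equiv_refl by (auto simp: brace_ext_class_def)
  \<comment> \<open>At least one section must exist, for otherwise the set of cosets would be empty
    and \<open>Lambda\<close> unspecified.\<close>
  moreover have "normalized_section ?M ?E (\<lambda>x. (x, 1\<^sub>K))"
    by (simp add: normalized_section_def induced_brace_ext_def)
  ultimately have "{B2N #>\<^bsub>Z2N\<^esub> section_cocycle ?M ?I F s | F s. F \<in> brace_ext_class ?M ?I ?E \<and> normalized_section ?M F s}
      = {B2N #>\<^bsub>Z2N\<^esub> brace_cochain z}"
    using sec by blast
  then show ?thesis
    by (simp add: Lambda_def z_eq)
qed

lemma Lambda_Pi_Psi_eq: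
  assumes z: "z \<in> carrier Z2"
  shows "(Lambda (induced_brace A) (induced_brace K) (xi_action A \<nu>) \<mu> (epsilon_action A K \<nu> \<mu> f)
      \<circ> Pi_map A K \<circ> Psi A K \<nu> \<mu> \<sigma> f) (B2 #>\<^bsub>Z2\<^esub> z) = B2N #>\<^bsub>Z2N\<^esub> brace_cochain z"
proof -
  interpret Z2: comm_group Z2 by (rule comm_group_Z2)
  interpret B2: normal B2 Z2 by (rule B2_normal)
  have "rrb_ext_equiv A K (cocycle_ext A K \<nu> \<mu> \<sigma> f z) (cocycle_ext A K \<nu> \<mu> \<sigma> f z)"
    using cocycle_ext_equiv[OF z Z2.rcos_self[OF z B2.subgroup_axioms]] .
  then show ?thesis
    using z by (simp add: Psi_eq Pi_map_eq cocycle_ext_extension Lambda_eq)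
qed

end

theorem proposition4p4:
  fixes A :: "('a, 'b) rrb" and K :: "('k, 'l) rrb"
    and \<nu> :: "'b \<Rightarrow> 'k \<Rightarrow> 'k" and \<mu> :: "'a \<Rightarrow> 'k \<Rightarrow> 'k"
    and \<sigma> :: "'b \<Rightarrow> 'l \<Rightarrow> 'l" and f :: "'l \<Rightarrow> 'a \<Rightarrow> 'k"
  assumes "rrb_group A" and "rrb_module A K \<nu> \<mu> \<sigma> f"
  shows "group_hom
           (H2_RRB A K \<nu> \<mu> \<sigma> f)
           (H2_N (induced_brace A) (induced_brace K)
              (xi_action A \<nu>) \<mu> (epsilon_action A K \<nu> \<mu> f))
           (Lambda (induced_brace A) (induced_brace K)
              (xi_action A \<nu>) \<mu> (epsilon_action A K \<nu> \<mu> f)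
            \<circ> Pi_map A K \<circ> Psi A K \<nu> \<mu> \<sigma> f)"
proof -
  interpret rrb_mod A K \<nu> \<mu> \<sigma> f
    using assms by unfold_locales
  have "brace_cochain ` B2 \<subseteq> B2N"
    using brace_cochain_coboundary by (auto simp: B2_RRB_def)
  then show ?thesis
    unfolding H2_RRB_def H2_N_def
    using B2_normal B2N_normal brace_cochain_hom Lambda_Pi_Psi_eq by (intro group_hom_FactGroup)
qed

end
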